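(* Let $m\in(2,\infty)$ and $\alpha\in(0,1)$, and let $(c_d(\alpha))_{d\in\mathbb{N}}$ be a sequence of real numbers such that $$\mathbb{P}\Big(\max_{1\le j\le d} Z_j> c_d(\alpha)\Big)\to\alpha\qquad\text{as } d\to\infty,$$ where, for each $d$, $Z=(Z_1,\dots,Z_d)$ is distributed as $\mathsf{N}_d(0_d,\mathbf{I}_d)$. Let $P_m$ be the probability distribution on $\mathbb{R}$ defined in the context. Then $P_m$, which depends neither on $n$ nor on $d$, has mean zero, variance one and finite $m$th absolute moment, and the following holds. Let $d=d(n)$, $n\in\mathbb{N}$, be a sequence of positive integers and, for each $n$, let $X_1,\dots,X_n$ be i.i.d. random vectors in $\mathbb{R}^{d(n)}$ with independent entries $X_{ij}\sim P_m$, $1\le i\le n$, $1\le j\le d(n)$. Let $S_n=n^{-1/2}\sum_{i=1}^n X_i$, with $j$th coordinate $S_{nj}$. If for some $\varepsilon\in(0,\infty)$ it holds that $$\limsup_{n\to\infty}\frac{d(n)}{n^{m/2-1+\varepsilon}}>0,$$ then $$\limsup_{n\to\infty}\left[\mathbb{P}\Big(\max_{1\le j\le d(n)} S_{nj}> c_{d(n)}(\alpha)\Big)-\mathbb{P}\Big(\max_{1\le j\le d(n)} Z_j> c_{d(n)}(\alpha)\Big)\right]=1-\alpha,$$ where in the second probability $Z\sim\mathsf{N}_{d(n)}(0_{d(n)},\mathbf{I}_{d(n)})$.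
   Context: Notation: $a\vee b=\max(a,b)$; $\mathsf{N}_d(0_d,\mathbf{I}_d)$ is the standard Gaussian distribution on $\mathbb{R}^d$. The dimension $d=d(n)$ is allowed to depend on the sample size $n$. Definition of $P_m$ for $m\in(2,\infty)$: let $G_m:\mathbb{R}\to[0,1]$ be the cumulative distribution function $$G_m(x)=\begin{cases}\dfrac{1}{2}\,\dfrac{1}{|x|^m[\ln(|x|)\vee 1]^2} & \text{for } x\in(-\infty,-1],\\[2mm] \dfrac12 & \text{for } x\in(-1,1),\\[2mm] 1-\dfrac{1}{2}\,\dfrac{1}{x^m[\ln(x)\vee 1]^2} & \text{for } x\in[1,\infty).\end{cases}$$ Let $\mu_{G_m}$ be the (Lebesgue–Stieltjes) probability measure on $\mathbb{R}$ with cdf $G_m$, and let $\sigma_m^2=\int_{\mathbb{R}}x^2\,\mu_{G_m}(dx)$, with $\sigma_m>0$. Then $P_m$ is the image (push-forward) of $\mu_{G_m}$ under the map $x\mapsto\sigma_m^{-1}x$; that is, $P_m$ is the distribution of $Y/\sigma_m$ when $Y$ has cdf $G_m$. *)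

theory Defs
  imports "HOL-Probability.Probability"
begin

definition G :: "real \<Rightarrow> real \<Rightarrow> real" where
  "G m x =
    (if x \<le> -1 then 1/2 * (1 / (\<bar>x\<bar> powr m * (max (ln \<bar>x\<bar>) 1)\<^sup>2))
     else if x < 1 then 1/2
     else 1 - 1/2 * (1 / (x powr m * (max (ln x) 1)\<^sup>2)))"

definition sigma :: "real \<Rightarrow> real" where
  "sigma m = sqrt (LINT x|interval_measure (G m). x\<^sup>2)"

definition P :: "real \<Rightarrow> real measure" where
  "P m = distr (interval_measure (G m)) borel (\<lambda>x. inverse (sigma m) * x)"

text \<open>Vectors in \<open>d\<close>-dimensional space, with \<open>d\<close> a term rather than a type, are functions on the
  index set \<open>{1..d}\<close>; the standard Gaussian law with identity covariance is the law of \<open>d\<close>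
  independent standard normal coordinates.\<close>

definition std_gaussian :: "nat \<Rightarrow> (nat \<Rightarrow> real) measure" where
  "std_gaussian d = Pi\<^sub>M {1..d} (\<lambda>_. std_normal_distribution)"

text \<open>Coordinate \<open>j\<close> of the normalized sum of \<open>x 1, \<dots>, x n\<close>, where \<open>x i j\<close> is coordinate \<open>j\<close> of the
  \<open>i\<close>-th vector.\<close>

definition normalized_sum :: "nat \<Rightarrow> (nat \<Rightarrow> nat \<Rightarrow> real) \<Rightarrow> nat \<Rightarrow> real" where
  "normalized_sum n x j = real n powr (-1/2) * (\<Sum>i=1..n. x i j)"

text \<open>\<open>X i j\<close> is the \<open>j\<close>-th coordinate of the \<open>i\<close>-th random vector. The first condition is independence
  of the vectors; the other two fix the law of each vector (to be the same product law), so the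
  vectors are in particular identically distributed.\<close>

definition iid_vectors_with_indep_entries ::
  "'a measure \<Rightarrow> real measure \<Rightarrow> nat \<Rightarrow> nat \<Rightarrow> (nat \<Rightarrow> nat \<Rightarrow> 'a \<Rightarrow> real) \<Rightarrow> bool" where
  "iid_vectors_with_indep_entries M Q n d X \<longleftrightarrow>
     prob_space.indep_vars M (\<lambda>_. Pi\<^sub>M {1..d} (\<lambda>_. borel))
       (\<lambda>i \<omega>. \<lambda>j\<in>{1..d}. X i j \<omega>) {1..n} \<and>
     (\<forall>i\<in>{1..n}. prob_space.indep_vars M (\<lambda>_. borel) (\<lambda>j. X i j) {1..d}) \<and>
     (\<forall>i\<in>{1..n}. \<forall>j\<in>{1..d}. distr M borel (X i j) = Q)"

end

theory Submission
  imports Defs "HOL-Real_Asymp.Real_Asymp"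
begin

text \<open>By independence \<open>P(max S \<le> c) = F n c ^ d\<close>, where \<open>F n\<close> is the distribution function of one
  coordinate of the normalized sum, and likewise for the Gaussian maximum with \<open>\<Phi>\<close>.
  For bounded \<open>d\<close> the difference vanishes by the central limit theorem, and for large \<open>d\<close> it is at
  most \<open>1 - P(max Z > c)\<close>, so the upper limit is at most \<open>1 - \<alpha>\<close>. Conversely, the Gaussian tail
  bound gives \<open>c d \<le> sqrt (2 ln (2 d / \<alpha>))\<close>, whereas a single large summand makes \<open>S\<close> exceed this level
  with probability at least \<open>n powr (1 - m/2)\<close> up to logarithms of \<open>d\<close>. Along the indices with
  \<open>d n \<ge> \<delta> n powr (m/2 - 1 + \<epsilon>)\<close> this is of larger order than \<open>1 / d\<close>, so the maximum
  exceeds \<open>c d\<close> with probability tending to one.\<close>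

section \<open>Independent and identically distributed sums\<close>

text \<open>Both sums have the characteristic function \<open>char Q\<close> raised to the common
  cardinality, so Levy uniqueness applies. The two families may live on different spaces; this
  serves for reflecting a sum, for comparing columns and for moving to a product space.\<close>

lemma distr_sum_iid_eq:
  fixes X :: "'i \<Rightarrow> 'a \<Rightarrow> real" and Y :: "'j \<Rightarrow> 'b \<Rightarrow> real"
  assumes M: "prob_space M" and N: "prob_space N"
    and X: "prob_space.indep_vars M (\<lambda>_. borel) X I" and Y: "prob_space.indep_vars N (\<lambda>_. borel) Y J"
    and dX: "\<And>i. i \<in> I \<Longrightarrow> distr M borel (X i) = Q" and dY: "\<And>j. j \<in> J \<Longrightarrow> distr N borel (Y j) = Q"
    and card: "card I = card J"
  shows "distr M borel (\<lambda>\<omega>. \<Sum>i\<in>I. X i \<omega>) = distr N borel (\<lambda>\<omega>. \<Sum>j\<in>J. Y j \<omega>)"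
proof -
  interpret M: prob_space M by fact
  interpret N: prob_space N by fact
  have mX: "X i \<in> borel_measurable M" if "i \<in> I" for i
    using X that by (simp add: M.indep_vars_def)
  have mY: "Y j \<in> borel_measurable N" if "j \<in> J" for j
    using Y that by (simp add: N.indep_vars_def)
  show ?thesis
  proof (rule Levy_uniqueness)
    show "real_distribution (distr M borel (\<lambda>\<omega>. \<Sum>i\<in>I. X i \<omega>))"
      by (rule M.real_distribution_distr) (intro borel_measurable_sum mX)
    show "real_distribution (distr N borel (\<lambda>\<omega>. \<Sum>j\<in>J. Y j \<omega>))"
      by (rule N.real_distribution_distr) (intro borel_measurable_sum mY)
    show "char (distr M borel (\<lambda>\<omega>. \<Sum>i\<in>I. X i \<omega>)) = char (distr N borel (\<lambda>\<omega>. \<Sum>j\<in>J. Y j \<omega>))"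
    proof
      fix t
      have "char (distr M borel (\<lambda>\<omega>. \<Sum>i\<in>I. X i \<omega>)) t = (\<Prod>i\<in>I. char Q t)"
        by (simp add: M.char_distr_sum[OF X] dX)
      also have "\<dots> = (\<Prod>j\<in>J. char Q t)"
        by (simp add: card)
      also have "\<dots> = char (distr N borel (\<lambda>\<omega>. \<Sum>j\<in>J. Y j \<omega>)) t"
        by (simp add: N.char_distr_sum[OF Y] dY)
      finally show "char (distr M borel (\<lambda>\<omega>. \<Sum>i\<in>I. X i \<omega>)) t = \<dots>" .
    qed
  qed
qed

section \<open>Independence: product spaces, maxima, rows and entries\<close>

lemma indep_vars_PiM_coordinates:
  assumes "prob_space Q" "sets Q = sets borel" "I \<noteq> {}"
  shows "prob_space.indep_vars (Pi\<^sub>M I (\<lambda>_. Q)) (\<lambda>_. borel) (\<lambda>i \<omega>. \<omega> i) I"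
    and "i \<in> I \<Longrightarrow> distr (Pi\<^sub>M I (\<lambda>_. Q)) borel (\<lambda>\<omega>. \<omega> i) = Q"
proof -
  interpret Q: prob_space Q by fact
  interpret P: product_prob_space "\<lambda>_. Q" I by unfold_locales
  note assms(2)[measurable_cong]
  have d: "distr (Pi\<^sub>M I (\<lambda>_. Q)) borel (\<lambda>\<omega>. \<omega> i) = Q" if "i \<in> I" for i
    using P.PiM_component[OF that] distr_cong[of "Pi\<^sub>M I (\<lambda>_. Q)" _ borel Q "\<lambda>\<omega>. \<omega> i"]
    by (simp add: assms(2))
  then show "i \<in> I \<Longrightarrow> distr (Pi\<^sub>M I (\<lambda>_. Q)) borel (\<lambda>\<omega>. \<omega> i) = Q" .
  have s: "sets (Pi\<^sub>M I (\<lambda>_. borel)) = sets (Pi\<^sub>M I (\<lambda>_. Q))"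
    by (rule sets_PiM_cong) (simp_all add: assms(2))
  \<comment> \<open>The coordinates together form the identity map, whose law is the product of the
    coordinate laws; this is the product-law criterion for independence.\<close>
  have "distr (Pi\<^sub>M I (\<lambda>_. Q)) (Pi\<^sub>M I (\<lambda>_. borel)) (\<lambda>\<omega>. \<lambda>i\<in>I. \<omega> i)
      = distr (Pi\<^sub>M I (\<lambda>_. Q)) (Pi\<^sub>M I (\<lambda>_. Q)) (\<lambda>\<omega>. \<omega>)"
    by (rule distr_cong) (auto simp: s space_PiM)
  also have "\<dots> = Pi\<^sub>M I (\<lambda>_. Q)" by simp
  also have "\<dots> = (\<Pi>\<^sub>M i\<in>I. distr (Pi\<^sub>M I (\<lambda>_. Q)) borel (\<lambda>\<omega>. \<omega> i))"
    by (intro PiM_cong) (simp_all add: d)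
  finally show "prob_space.indep_vars (Pi\<^sub>M I (\<lambda>_. Q)) (\<lambda>_. borel) (\<lambda>i \<omega>. \<omega> i) I"
    using assms(3) by (subst P.indep_vars_iff_distr_eq_PiM') auto
qed

lemma (in prob_space) prob_Max_gt:
  fixes Y :: "'i \<Rightarrow> 'a \<Rightarrow> real"
  assumes Y: "indep_vars (\<lambda>_. borel) Y J" and J: "J \<noteq> {}" "finite J"
    and F: "\<And>j. j \<in> J \<Longrightarrow> \<P>(\<omega> in M. Y j \<omega> \<le> c) = F"
  shows "\<P>(\<omega> in M. Max ((\<lambda>j. Y j \<omega>) ` J) > c) = 1 - F ^ card J"
proof -
  have mY: "Y j \<in> borel_measurable M" if "j \<in> J" for j
    using Y that by (simp add: indep_vars_def)
  have ev: "{\<omega>\<in>space M. \<forall>j\<in>J. Y j \<omega> \<le> c} \<in> events"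
    using J by (intro sets.sets_Collect_finite_All' borel_measurable_le mY borel_measurable_const) auto
  have "{\<omega>\<in>space M. \<forall>j\<in>J. Y j \<omega> \<le> c} = (\<Inter>j\<in>J. Y j -` {..c} \<inter> space M)"
    using J by auto
  then have "\<P>(\<omega> in M. \<forall>j\<in>J. Y j \<omega> \<le> c) = (\<Prod>j\<in>J. prob (Y j -` {..c} \<inter> space M))"
    using indep_varsD[OF Y J subset_refl, of "\<lambda>_. {..c}"] by simp
  also have "\<dots> = (\<Prod>j\<in>J. F)"
  proof (rule prod.cong[OF refl])
    fix j assume "j \<in> J"
    then show "prob (Y j -` {..c} \<inter> space M) = F"
      by (subst F[symmetric]) (auto intro!: arg_cong[where f=prob])
  qed
  finally have *: "\<P>(\<omega> in M. \<forall>j\<in>J. Y j \<omega> \<le> c) = F ^ card J" by simp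
  have "{\<omega>\<in>space M. Max ((\<lambda>j. Y j \<omega>) ` J) > c} = space M - {\<omega>\<in>space M. \<forall>j\<in>J. Y j \<omega> \<le> c}"
    using J by (auto simp: Max_gr_iff not_le)
  then show ?thesis
    using prob_compl[OF ev] * by simp
qed

text \<open>A box event over \<open>I \<times> J\<close> is an intersection over \<open>i\<close> of
  box events of single rows. Its probability factors first over the rows and then, inside each row,
  over the entries.\<close>

lemma (in prob_space) indep_vars_rows_imp_indep_entries:
  fixes X :: "'i \<Rightarrow> 'j \<Rightarrow> 'a \<Rightarrow> real"
  assumes I: "finite I" "I \<noteq> {}" and J: "finite J" "J \<noteq> {}"
    and rows: "indep_vars (\<lambda>_. Pi\<^sub>M J (\<lambda>_. borel)) (\<lambda>i \<omega>. \<lambda>j\<in>J. X i j \<omega>) I"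
    and entries: "\<And>i. i \<in> I \<Longrightarrow> indep_vars (\<lambda>_. borel) (X i) J"
  shows "indep_vars (\<lambda>_. borel) (\<lambda>(i, j). X i j) (I \<times> J)"
proof -
  have mX: "X i j \<in> borel_measurable M" if "i \<in> I" "j \<in> J" for i j
    using entries[OF that(1)] that by (simp add: indep_vars_def)
  show ?thesis
  proof (subst indep_vars_finite[where E="\<lambda>_. sets borel"])
    show "\<forall>A\<in>I \<times> J \<rightarrow> sets borel.
       prob (\<Inter>p\<in>I \<times> J. (case p of (i, j) \<Rightarrow> X i j) -` A p \<inter> space M) =
       (\<Prod>p\<in>I \<times> J. prob ((case p of (i, j) \<Rightarrow> X i j) -` A p \<inter> space M))"
    proof
      fix A :: "'i \<times> 'j \<Rightarrow> real set" assume A: "A \<in> I \<times> J \<rightarrow> sets borel"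
      let ?B = "\<lambda>i. Pi\<^sub>E J (\<lambda>j. A (i, j))"
      have B: "?B i \<in> sets (Pi\<^sub>M J (\<lambda>_. borel))" if "i \<in> I" for i
        using A that J by (intro sets_PiM_I_finite) auto
      have row: "(\<lambda>\<omega>. \<lambda>j\<in>J. X i j \<omega>) -` ?B i \<inter> space M = (\<Inter>j\<in>J. X i j -` A (i, j) \<inter> space M)" for i
        using J by (auto simp: PiE_iff restrict_def extensional_def)
      have "(\<Inter>p\<in>I \<times> J. (case p of (i, j) \<Rightarrow> X i j) -` A p \<inter> space M)
          = (\<Inter>i\<in>I. (\<lambda>\<omega>. \<lambda>j\<in>J. X i j \<omega>) -` ?B i \<inter> space M)"
        unfolding row using I J by auto
      also have "prob \<dots> = (\<Prod>i\<in>I. prob ((\<lambda>\<omega>. \<lambda>j\<in>J. X i j \<omega>) -` ?B i \<inter> space M))"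
        using I B by (intro indep_varsD[OF rows]) auto
      also have "\<dots> = (\<Prod>i\<in>I. \<Prod>j\<in>J. prob (X i j -` A (i, j) \<inter> space M))"
        unfolding row using J A by (intro prod.cong refl indep_varsD[OF entries]) auto
      also have "\<dots> = (\<Prod>p\<in>I \<times> J. prob ((case p of (i, j) \<Rightarrow> X i j) -` A p \<inter> space M))"
        by (simp add: prod.cartesian_product case_prod_beta')
      finally show "prob (\<Inter>p\<in>I \<times> J. (case p of (i, j) \<Rightarrow> X i j) -` A p \<inter> space M) = \<dots>" .
    qed
  qed (use I J mX in \<open>auto simp: Int_stable_def sets.sigma_sets_eq[of borel, simplified]\<close>)
qed

section \<open>Symmetric sums and single large summands\<close>

text \<open>The sum has the same law as its negative, so the events that it is
  \<open>\<ge> 0\<close> and \<open>\<le> 0\<close> are equally likely, and together they cover the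
  space.\<close>

lemma (in prob_space) symmetric_sum_nonneg:
  fixes X :: "'i \<Rightarrow> 'a \<Rightarrow> real"
  assumes X: "indep_vars (\<lambda>_. borel) X I"
    and dX: "\<And>i. i \<in> I \<Longrightarrow> distr M borel (X i) = Q"
    and sym: "distr Q borel uminus = Q"
  shows "\<P>(\<omega> in M. (\<Sum>i\<in>I. X i \<omega>) \<ge> 0) \<ge> 1 / 2"
proof -
  have mX[measurable]: "X i \<in> borel_measurable M" if "i \<in> I" for i
    using X that by (simp add: indep_vars_def)
  let ?S = "\<lambda>\<omega>. \<Sum>i\<in>I. X i \<omega>"
  have mS[measurable]: "?S \<in> borel_measurable M" by (intro borel_measurable_sum mX)
  have "distr M borel ?S = distr M borel (\<lambda>\<omega>. \<Sum>i\<in>I. - X i \<omega>)"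
  proof (rule distr_sum_iid_eq[where Q=Q, OF prob_space_axioms prob_space_axioms X])
    show "indep_vars (\<lambda>_. borel) (\<lambda>i \<omega>. - X i \<omega>) I"
      by (rule indep_vars_compose2[OF X]) auto
    show "distr M borel (\<lambda>\<omega>. - X i \<omega>) = Q" if "i \<in> I" for i
    proof -
      have "distr M borel (\<lambda>\<omega>. - X i \<omega>) = distr (distr M borel (X i)) borel uminus"
        using mX[OF that] by (subst distr_distr) (auto simp: comp_def)
      then show ?thesis by (simp add: dX[OF that] sym)
    qed
  qed (auto simp: dX)
  then have "measure (distr M borel ?S) {0..} = measure (distr M borel (\<lambda>\<omega>. - ?S \<omega>)) {0..}"
    by (simp add: sum_negf)
  moreover have "measure (distr M borel ?S) {0..} = \<P>(\<omega> in M. ?S \<omega> \<ge> 0)"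
    by (subst measure_distr) (auto intro!: arg_cong[where f=prob])
  moreover have "measure (distr M borel (\<lambda>\<omega>. - ?S \<omega>)) {0..} = \<P>(\<omega> in M. ?S \<omega> \<le> 0)"
    by (subst measure_distr) (auto intro!: arg_cong[where f=prob])
  ultimately have eq: "\<P>(\<omega> in M. ?S \<omega> \<ge> 0) = \<P>(\<omega> in M. ?S \<omega> \<le> 0)" by simp
  have "1 = prob ({\<omega>\<in>space M. ?S \<omega> \<ge> 0} \<union> {\<omega>\<in>space M. ?S \<omega> \<le> 0})"
    by (subst prob_space[symmetric]) (auto intro!: arg_cong[where f=prob])
  also have "\<dots> \<le> \<P>(\<omega> in M. ?S \<omega> \<ge> 0) + \<P>(\<omega> in M. ?S \<omega> \<le> 0)"
    by (intro measure_Un_le) auto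
  finally show ?thesis using eq by simp
qed

text \<open>One big jump: the events that \<open>X i\<close> is the only summand above \<open>t\<close> and that the other
  summands have nonnegative sum are disjoint, and each of them forces the sum above \<open>t\<close>.\<close>

lemma (in prob_space) symmetric_sum_tail_ge:
  fixes X :: "'i \<Rightarrow> 'a \<Rightarrow> real" and t :: real
  assumes fin: "finite I" and X: "indep_vars (\<lambda>_. borel) X I"
    and dX: "\<And>i. i \<in> I \<Longrightarrow> distr M borel (X i) = Q"
    and sym: "distr Q borel uminus = Q"
  defines "p \<equiv> measure Q {t<..} :: real"
  shows "\<P>(\<omega> in M. (\<Sum>i\<in>I. X i \<omega>) > t) \<ge> real (card I) * p * (1 / 2 - real (card I) * p)"
proof -
  have mX: "X i \<in> borel_measurable M" if "i \<in> I" for i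
    using X that by (simp add: indep_vars_def)
  have p: "prob (X i -` {t<..} \<inter> space M) = p" if "i \<in> I" for i
    using that mX[OF that] by (simp add: p_def dX[OF that, symmetric] measure_distr)
  \<comment> \<open>The condition on the other summands is phrased as a measurable set of restricted
    families, so that independence of the restrictions to \<open>{i}\<close> and to
    \<open>I - {i}\<close> can be used.\<close>
  define B where "B i = {f. (\<forall>j\<in>I - {i}. f j \<le> t) \<and> (\<Sum>j\<in>I - {i}. f j) \<ge> (0::real)} \<inter> space (Pi\<^sub>M (I - {i}) (\<lambda>_. borel))"
    for i
  have B: "B i \<in> sets (Pi\<^sub>M (I - {i}) (\<lambda>_. borel))" for i
  proof -
    have "{f \<in> space (Pi\<^sub>M (I - {i}) (\<lambda>_. borel)). (\<forall>j\<in>I - {i}. f j \<le> t) \<and> (\<Sum>j\<in>I - {i}. f j) \<ge> (0::real)}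
      \<in> sets (Pi\<^sub>M (I - {i}) (\<lambda>_. borel))"
      using fin by (intro sets.sets_Collect_conj sets.sets_Collect_finite_All) auto
    then show ?thesis by (simp add: B_def Int_def conj_commute)
  qed
  define R where "R i = (\<lambda>\<omega>. restrict (\<lambda>j. X j \<omega>) (I - {i}))" for i
  define E where "E i = X i -` {t<..} \<inter> space M \<inter> R i -` B i" for i
  have mR: "R i \<in> measurable M (Pi\<^sub>M (I - {i}) (\<lambda>_. borel))" for i
    unfolding R_def by (intro measurable_restrict mX) auto
  \<comment> \<open>The other summands have nonnegative sum with probability at least 1/2; by the
    union bound, some summand exceeds \<open>t\<close> with probability at most
    \<open>card I * p\<close>.\<close>
  have rest: "prob (R i -` B i \<inter> space M) \<ge> 1 / 2 - card I * p" if i: "i \<in> I" for i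
  proof -
    have "1 / 2 \<le> \<P>(\<omega> in M. (\<Sum>j\<in>I-{i}. X j \<omega>) \<ge> 0)"
      by (rule symmetric_sum_nonneg[where Q=Q, OF indep_vars_subset[OF X]]) (auto simp: dX sym)
    also have "\<dots> \<le> prob (R i -` B i \<inter> space M \<union> (\<Union>j\<in>I. X j -` {t<..} \<inter> space M))"
    proof (rule finite_measure_mono)
      show "{\<omega> \<in> space M. (\<Sum>j\<in>I-{i}. X j \<omega>) \<ge> 0}
          \<subseteq> R i -` B i \<inter> space M \<union> (\<Union>j\<in>I. X j -` {t<..} \<inter> space M)"
        by (auto simp: R_def B_def space_PiM not_le[symmetric])
      show "R i -` B i \<inter> space M \<union> (\<Union>j\<in>I. X j -` {t<..} \<inter> space M) \<in> events"
        using fin mX by (intro sets.Un sets.finite_UN measurable_sets[OF mR B]) auto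
    qed
    also have "\<dots> \<le> prob (R i -` B i \<inter> space M) + prob (\<Union>j\<in>I. X j -` {t<..} \<inter> space M)"
      using fin mX by (intro measure_Un_le sets.finite_UN measurable_sets[OF mR B]) auto
    also have "prob (\<Union>j\<in>I. X j -` {t<..} \<inter> space M) \<le> (\<Sum>j\<in>I. prob (X j -` {t<..} \<inter> space M))"
      using fin mX by (intro measure_UNION_le) auto
    also have "\<dots> = card I * p" by (simp add: p)
    finally show ?thesis by simp
  qed
  have E: "prob (E i) \<ge> p * (1 / 2 - card I * p)" "E i \<in> events" if i: "i \<in> I" for i
  proof -
    have "indep_var (PiM {i} (\<lambda>_. borel)) (\<lambda>\<omega>. restrict (\<lambda>j. X j \<omega>) {i}) (PiM (I - {i}) (\<lambda>_. borel)) (R i)"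
      unfolding R_def using i by (intro indep_var_restrict[OF X]) auto
    from indep_varD[OF this _ B[of i], of "{f \<in> space (PiM {i} (\<lambda>_. borel)). f i > t}"]
    have "prob ((\<lambda>\<omega>. (restrict (\<lambda>j. X j \<omega>) {i}, R i \<omega>)) -`
        ({f \<in> space (PiM {i} (\<lambda>_. borel)). f i > t} \<times> B i) \<inter> space M)
      = prob ((\<lambda>\<omega>. restrict (\<lambda>j. X j \<omega>) {i}) -` {f \<in> space (PiM {i} (\<lambda>_. borel)). f i > t} \<inter> space M)
        * prob (R i -` B i \<inter> space M)"
      by simp
    also have "(\<lambda>\<omega>. (restrict (\<lambda>j. X j \<omega>) {i}, R i \<omega>)) -`
        ({f \<in> space (PiM {i} (\<lambda>_. borel)). f i > t} \<times> B i) \<inter> space M = E i"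
      by (auto simp: E_def space_PiM)
    also have "(\<lambda>\<omega>. restrict (\<lambda>j. X j \<omega>) {i}) -` {f \<in> space (PiM {i} (\<lambda>_. borel)). f i > t} \<inter> space M
        = X i -` {t<..} \<inter> space M"
      by (auto simp: space_PiM)
    finally have "prob (E i) = p * prob (R i -` B i \<inter> space M)"
      by (simp add: p[OF i])
    then show "prob (E i) \<ge> p * (1 / 2 - card I * p)"
      using rest[OF i] by (simp add: mult_left_mono p_def)
    have "E i = (X i -` {t<..} \<inter> space M) \<inter> (R i -` B i \<inter> space M)"
      by (auto simp: E_def)
    then show "E i \<in> events"
      using measurable_sets[OF mR B] mX[OF i] by auto
  qed
  have disj: "disjoint_family_on E I"
  proof (unfold disjoint_family_on_def, intro ballI impI)
    fix i j assume ij: "i \<in> I" "j \<in> I" "i \<noteq> j"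
    have "X j \<omega> \<le> t" if "\<omega> \<in> E i" for \<omega>
      using that ij by (auto simp: E_def R_def B_def)
    moreover have "X j \<omega> > t" if "\<omega> \<in> E j" for \<omega>
      using that by (auto simp: E_def)
    ultimately show "E i \<inter> E j = {}"
      by (auto simp: not_le[symmetric])
  qed
  have sub: "(\<Union>i\<in>I. E i) \<subseteq> {\<omega>\<in>space M. (\<Sum>i\<in>I. X i \<omega>) > t}"
  proof safe
    fix i \<omega> assume i: "i \<in> I" "\<omega> \<in> E i"
    then show "\<omega> \<in> space M" by (simp add: E_def)
    have "(\<Sum>i\<in>I. X i \<omega>) = X i \<omega> + (\<Sum>j\<in>I-{i}. X j \<omega>)"
      using fin i(1) by (rule sum.remove)
    moreover have "(\<Sum>j\<in>I-{i}. X j \<omega>) \<ge> 0" "X i \<omega> > t"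
      using i by (auto simp: E_def B_def R_def)
    ultimately show "(\<Sum>i\<in>I. X i \<omega>) > t" by simp
  qed
  have "card I * p * (1 / 2 - card I * p) = (\<Sum>i\<in>I. p * (1 / 2 - card I * p))" by simp
  also have "\<dots> \<le> (\<Sum>i\<in>I. prob (E i))" by (intro sum_mono E)
  also have "\<dots> = prob (\<Union>i\<in>I. E i)"
    using fin E disj by (intro finite_measure_finite_Union[symmetric]) auto
  also have "\<dots> \<le> \<P>(\<omega> in M. (\<Sum>i\<in>I. X i \<omega>) > t)"
  proof (rule finite_measure_mono[OF sub])
    have "(\<lambda>\<omega>. \<Sum>i\<in>I. X i \<omega>) \<in> borel_measurable M" by (intro borel_measurable_sum mX)
    then show "{\<omega>\<in>space M. (\<Sum>i\<in>I. X i \<omega>) > t} \<in> events" by measurable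
  qed
  finally show ?thesis .
qed

section \<open>Central limit theorem and Gaussian tail\<close>

text \<open>The spaces \<open>M n\<close> vary with \<open>n\<close>, but only the law of each row
  sum matters, and it equals the law of a partial sum of coordinates on the one infinite product of
  \<open>Q\<close>. The central limit theorem is applied there.\<close>

lemma clt_triangular_iid:
  fixes X :: "nat \<Rightarrow> nat \<Rightarrow> 'a \<Rightarrow> real"
  assumes Q: "real_distribution Q" "integrable Q (\<lambda>x. x\<^sup>2)" "(LINT x|Q. x) = 0" "(LINT x|Q. x\<^sup>2) = 1"
    and M: "\<And>n. n \<ge> 1 \<Longrightarrow> prob_space (M n)"
    and X: "\<And>n. n \<ge> 1 \<Longrightarrow> prob_space.indep_vars (M n) (\<lambda>_. borel) (X n) {1..n}"
    and dX: "\<And>n i. n \<ge> 1 \<Longrightarrow> i \<in> {1..n} \<Longrightarrow> distr (M n) borel (X n i) = Q"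
  shows "(\<lambda>n. \<P>(\<omega> in M n. real n powr (-1/2) * (\<Sum>i=1..n. X n i \<omega>) \<le> x))
           \<longlonglongrightarrow> cdf std_normal_distribution x"
proof -
  interpret Q: real_distribution Q by fact
  let ?W = "Pi\<^sub>M (UNIV :: nat set) (\<lambda>_. Q)"
  interpret W: prob_space ?W by (intro prob_space_PiM Q.prob_space_axioms)
  note coord = indep_vars_PiM_coordinates[OF Q.prob_space_axioms Q.events_eq_borel, of "UNIV :: nat set", simplified]
  have m[measurable]: "(\<lambda>\<omega>. \<omega> i) \<in> borel_measurable ?W" for i :: nat
    using coord(1) by (simp add: W.indep_vars_def)
  have int: "integrable ?W (\<lambda>\<omega>. f (\<omega> i)) \<longleftrightarrow> integrable Q f" "(LINT \<omega>|?W. f (\<omega> i)) = (LINT x|Q. f x)"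
    if "f \<in> borel_measurable borel" for f :: "real \<Rightarrow> real" and i :: nat
    using integrable_distr_eq[OF m[of i] that] integral_distr[OF m[of i] that] by (simp_all add: coord(2))
  have "weak_conv_m (\<lambda>n. distr ?W borel (\<lambda>\<omega>. (\<Sum>i<n. \<omega> i) / sqrt (real n * 1\<^sup>2))) std_normal_distribution"
  proof (rule W.central_limit_theorem_zero_mean[where \<mu>=Q])
    show "W.indep_vars (\<lambda>_. borel) (\<lambda>i \<omega>. \<omega> i) UNIV" by (rule coord)
    fix i :: nat
    show "W.expectation (\<lambda>\<omega>. \<omega> i) = 0"
      using int(2)[of "\<lambda>x. x" i] Q by simp
    show "integrable ?W (\<lambda>\<omega>. (\<omega> i)\<^sup>2)"
      using int(1)[of "\<lambda>x. x\<^sup>2" i] Q by simp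
    show "W.variance (\<lambda>\<omega>. \<omega> i) = 1\<^sup>2"
      using int(2)[of "\<lambda>x. x" i] int(2)[of "\<lambda>x. x\<^sup>2" i] Q by simp
    show "distr ?W borel (\<lambda>\<omega>. \<omega> i) = Q" by (rule coord)
  qed simp
  \<comment> \<open>Weak convergence gives convergence of distribution functions only at continuity
    points of the limit; a law with a density has no atoms, so every \<open>x\<close> is
    one.\<close>
  moreover have "isCont (cdf std_normal_distribution) x"
  proof -
    interpret N: real_distribution std_normal_distribution by (rule real_dist_normal_dist)
    have "emeasure std_normal_distribution {x} = 0"
      by (subst emeasure_density) (auto intro!: nn_integral_null_set)
    then show ?thesis by (simp add: N.isCont_cdf measure_def)
  qed
  ultimately have "(\<lambda>n. cdf (distr ?W borel (\<lambda>\<omega>. (\<Sum>i<n. \<omega> i) / sqrt (real n))) x)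
      \<longlonglongrightarrow> cdf std_normal_distribution x"
    by (simp add: weak_conv_m_def weak_conv_def)
  moreover have "eventually (\<lambda>n. cdf (distr ?W borel (\<lambda>\<omega>. (\<Sum>i<n. \<omega> i) / sqrt (real n))) x
     = \<P>(\<omega> in M n. real n powr (-1/2) * (\<Sum>i=1..n. X n i \<omega>) \<le> x)) sequentially"
    using eventually_ge_at_top[of 1]
  proof eventually_elim
    case (elim n)
    interpret M: prob_space "M n" using M elim by simp
    have mX: "X n i \<in> borel_measurable (M n)" if "i \<in> {1..n}" for i
      using X[OF elim] that by (simp add: M.indep_vars_def)
    have eq: "real n powr (-1/2) * s = s / sqrt (real n)" for s
      using powr_minus_divide[of "real n" "1/2"] by (simp add: powr_half_sqrt)
    \<comment> \<open>The index sets \<open>{..<n}\<close> and \<open>{1..n}\<close> differ by a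
      shift; only their equal cardinality matters.\<close>
    have "distr ?W borel (\<lambda>\<omega>. \<Sum>i<n. \<omega> i) = distr (M n) borel (\<lambda>\<omega>. \<Sum>i=1..n. X n i \<omega>)"
      using dX[OF elim] coord(2)
      by (intro distr_sum_iid_eq[where Q=Q] W.prob_space_axioms M.prob_space_axioms X[OF elim]
          W.indep_vars_subset[OF coord(1)]) auto
    then have "measure (distr ?W borel (\<lambda>\<omega>. \<Sum>i<n. \<omega> i)) {s. s / sqrt n \<le> x}
      = measure (distr (M n) borel (\<lambda>\<omega>. \<Sum>i=1..n. X n i \<omega>)) {s. s / sqrt n \<le> x}" by simp
    moreover have "measure (distr ?W borel (\<lambda>\<omega>. \<Sum>i<n. \<omega> i)) {s. s / sqrt n \<le> x}
        = cdf (distr ?W borel (\<lambda>\<omega>. (\<Sum>i<n. \<omega> i) / sqrt (real n))) x"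
      unfolding cdf_def
      by (subst (1 2) measure_distr) (auto intro!: arg_cong[where f="measure ?W"])
    moreover have "measure (distr (M n) borel (\<lambda>\<omega>. \<Sum>i=1..n. X n i \<omega>)) {s. s / sqrt n \<le> x}
       = \<P>(\<omega> in M n. real n powr (-1/2) * (\<Sum>i=1..n. X n i \<omega>) \<le> x)"
      unfolding eq
      by (subst measure_distr) (auto intro!: arg_cong[where f="measure (M n)"] borel_measurable_sum mX)
    ultimately show ?case by simp
  qed
  ultimately show ?thesis by (blast intro: Lim_transform_eventually)
qed

text \<open>For \<open>x > c \<ge> 0\<close> the square of \<open>x\<close> is at least the sum of
  the squares of \<open>c\<close> and \<open>x - c\<close>. Hence the standard density at
  \<open>x\<close> is at most \<open>exp\<close> of minus half the square of \<open>c\<close> times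
  the density of the normal law centred at \<open>c\<close>, which has total mass one.\<close>

lemma std_normal_tail_le:
  assumes "c \<ge> 0"
  shows "1 - cdf std_normal_distribution c \<le> exp (- c\<^sup>2 / 2)"
proof -
  interpret N: real_distribution std_normal_distribution by (rule real_dist_normal_dist)
  have "1 - cdf std_normal_distribution c = measure std_normal_distribution {c<..}"
    using N.prob_compl[of "{..c}"] by (simp add: cdf_def Compl_eq_Diff_UNIV[symmetric])
  also have "ennreal \<dots> = (\<integral>\<^sup>+x. ennreal (std_normal_density x) * indicator {c<..} x \<partial>lborel)"
    by (subst N.emeasure_eq_measure[symmetric], subst emeasure_density) auto
  also have "\<dots> \<le> (\<integral>\<^sup>+x. ennreal (exp (- c\<^sup>2 / 2)) * ennreal (normal_density c 1 x) \<partial>lborel)"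
  proof (rule nn_integral_mono)
    fix x :: real
    have "std_normal_density x \<le> exp (- c\<^sup>2 / 2) * normal_density c 1 x" if "c < x"
    proof -
      have "- x\<^sup>2 / 2 \<le> - c\<^sup>2 / 2 + (- (x - c)\<^sup>2 / 2)"
        using mult_left_mono[of c x c] that assms by (simp add: power2_eq_square algebra_simps)
      then have "exp (- x\<^sup>2 / 2) \<le> exp (- c\<^sup>2 / 2) * exp (- (x - c)\<^sup>2 / 2)"
        by (simp add: exp_add[symmetric])
      then show ?thesis
        by (simp add: normal_density_def std_normal_density_def divide_right_mono)
    qed
    then show "ennreal (std_normal_density x) * indicator {c<..} x
        \<le> ennreal (exp (- c\<^sup>2 / 2)) * ennreal (normal_density c 1 x)"
      by (auto simp: ennreal_mult'[symmetric] ennreal_leI split: split_indicator)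
  qed
  also have "\<dots> = ennreal (exp (- c\<^sup>2 / 2)) * emeasure (density lborel (normal_density c 1)) UNIV"
    by (subst emeasure_density) (auto simp: nn_integral_cmult)
  also have "\<dots> = ennreal (exp (- c\<^sup>2 / 2))"
    using prob_space.emeasure_space_1[OF prob_space_normal_density[of 1 c]] by simp
  finally show ?thesis by (simp add: ennreal_le_iff)
qed

section \<open>The heavy-tailed law\<close>

text \<open>The cut-off \<open>max x 1\<close> extends the tail continuously to the whole line with
  value 1/2 to the left of 1. On \<open>x \<ge> 0\<close> it is the upper tail
  \<open>1 - G m x\<close>.\<close>

definition tail :: "real \<Rightarrow> real \<Rightarrow> real" where
  "tail m x = 1/2 * (1 / (max x 1 powr m * (max (ln (max x 1)) 1)\<^sup>2))"

lemma tail_nonneg: "0 \<le> tail m x"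
  by (simp add: tail_def)

lemma tail_le_1: "x \<le> 1 \<Longrightarrow> tail m x = 1 / 2"
  by (simp add: tail_def max_def)

lemma tail_antimono:
  assumes "m \<ge> 0" "x \<le> y"
  shows "tail m y \<le> tail m x"
proof -
  have "max x 1 powr m * (max (ln (max x 1)) 1)\<^sup>2 \<le> max y 1 powr m * (max (ln (max y 1)) 1)\<^sup>2"
    using assms by (intro mult_mono power_mono powr_mono2 max.mono) auto
  moreover have "0 < max x 1 powr m * (max (ln (max x 1)) 1)\<^sup>2"
    by (intro mult_pos_pos) auto
  ultimately show ?thesis
    unfolding tail_def by (intro mult_left_mono divide_left_mono mult_pos_pos) auto
qed

lemma isCont_tail: "isCont (tail m) x"
  unfolding tail_def[abs_def]
  by (intro continuous_intros) (auto simp: max_def)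

lemma tail_at_top:
  assumes "m > 0"
  shows "(tail m \<longlongrightarrow> 0) at_top"
proof (rule tendsto_sandwich[where f="\<lambda>_. 0" and h="\<lambda>x. x powr (-m)"])
  show "((\<lambda>x. x powr (-m)) \<longlongrightarrow> 0) at_top"
    using assms by (intro tendsto_neg_powr filterlim_ident) auto
  show "eventually (\<lambda>x. tail m x \<le> x powr (-m)) at_top"
    using eventually_ge_at_top[of 1]
  proof eventually_elim
    case (elim x)
    have "x powr m * 1 \<le> x powr m * (max (ln x) 1)\<^sup>2"
      by (intro mult_left_mono one_le_power) auto
    then have "1 / (x powr m * (max (ln x) 1)\<^sup>2) \<le> 1 / x powr m"
      using elim by (intro divide_left_mono mult_pos_pos) auto
    moreover have "0 \<le> 1 / x powr m" by simp
    moreover have "x powr (-m) = 1 / x powr m"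
      by (rule powr_minus_divide)
    moreover have "tail m x = 1/2 * (1 / (x powr m * (max (ln x) 1)\<^sup>2))"
      using elim by (simp add: tail_def max_absorb1)
    ultimately show ?case by linarith
  qed
qed (simp_all add: tail_nonneg)

text \<open>At each point at least one of the two tail terms sits at its constant value 1/2, which
  produces the three cases of \<open>G\<close>. Monotonicity, continuity and symmetry of
  \<open>G\<close> are all read off from this form.\<close>

lemma G_eq_tail: "G m x = 1 / 2 + tail m (- x) - tail m x"
  by (auto simp: G_def tail_def max_def abs_if)

lemma G_props:
  assumes "m > 0"
  shows G_mono: "x \<le> y \<Longrightarrow> G m x \<le> G m y"
    and G_right_cont: "continuous (at_right x) (G m)"
    and G_at_bot: "(G m \<longlongrightarrow> 0) at_bot"
    and G_at_top: "(G m \<longlongrightarrow> 1) at_top"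
proof -
  have G: "G m = (\<lambda>x. 1 / 2 + tail m (- x) - tail m x)"
    by (simp add: fun_eq_iff G_eq_tail)
  show "x \<le> y \<Longrightarrow> G m x \<le> G m y"
    using tail_antimono[of m x y] tail_antimono[of m "-y" "-x"] assms by (simp add: G_eq_tail)
  have "isCont (\<lambda>x. tail m (- x)) x"
    by (rule isCont_o2[OF _ isCont_tail]) auto
  then show "continuous (at_right x) (G m)"
    unfolding G by (intro continuous_at_imp_continuous_at_within[OF continuous_diff]
        continuous_add continuous_const isCont_tail)
  have neg: "((\<lambda>x. tail m (- x)) \<longlongrightarrow> 0) at_bot"
    by (rule filterlim_compose[OF tail_at_top[OF assms] filterlim_uminus_at_top_at_bot])
  have half: "eventually (\<lambda>x. tail m x = 1 / 2) at_bot" "eventually (\<lambda>x. tail m (- x) = 1 / 2) at_top"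
    by (rule eventually_mono[OF eventually_le_at_bot[of 1]], simp add: tail_le_1)
      (rule eventually_mono[OF eventually_ge_at_top[of "-1"]], simp add: tail_le_1)
  show "(G m \<longlongrightarrow> 0) at_bot"
    unfolding G using tendsto_diff[OF tendsto_add[OF tendsto_const[of "1/2"] neg] tendsto_eventually[OF half(1)]]
    by simp
  show "(G m \<longlongrightarrow> 1) at_top"
    unfolding G using tendsto_diff[OF tendsto_add[OF tendsto_const[of "1/2"] tendsto_eventually[OF half(2)]]
        tail_at_top[OF assms]]
    by simp
qed

lemma real_distribution_G: "m > 0 \<Longrightarrow> real_distribution (interval_measure (G m))"
  by (intro real_distribution_interval_measure G_props)

lemma cdf_G: "m > 0 \<Longrightarrow> cdf (interval_measure (G m)) = G m"
  by (intro cdf_interval_measure G_props)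

lemma measure_G_greaterThan:
  assumes "m > 0"
  shows "measure (interval_measure (G m)) {x<..} = 1 - G m x"
proof -
  interpret real_distribution "interval_measure (G m)" by (rule real_distribution_G[OF assms])
  show ?thesis
    using prob_compl[of "{..x}"] cdf_G[OF assms, THEN fun_cong, of x]
    by (simp add: cdf_def Compl_eq_Diff_UNIV[symmetric])
qed

text \<open>The reflected law has distribution function \<open>1 - G m (- x)\<close> plus the mass
  at \<open>- x\<close>. Continuity of \<open>G m\<close> removes the atom, and the tail form gives
  \<open>1 - G m (- x) = G m x\<close>.\<close>

lemma symmetric_G:
  assumes "m > 0"
  shows "distr (interval_measure (G m)) borel uminus = interval_measure (G m)"
proof -
  interpret real_distribution "interval_measure (G m)" by (rule real_distribution_G[OF assms])
  show ?thesis
  proof (rule cdf_unique)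
    show "real_distribution (distr (interval_measure (G m)) borel uminus)"
      by (rule real_distribution_distr) simp
    show "cdf (distr (interval_measure (G m)) borel uminus) = cdf (interval_measure (G m))"
    proof
      fix x
      have "isCont (G m) (-x)"
      proof -
        have "isCont (\<lambda>x. tail m (- x)) (-x)"
          by (rule isCont_o2[OF _ isCont_tail]) auto
        then show ?thesis
          unfolding G_eq_tail[abs_def] by (intro continuous_intros isCont_tail)
      qed
      then have 0: "prob {-x} = 0"
        using isCont_cdf cdf_G[OF assms] by simp
      have "cdf (distr (interval_measure (G m)) borel uminus) x = prob (uminus -` {..x})"
        by (simp add: cdf_def measure_distr)
      also have "uminus -` {..x} = {-x} \<union> {-x<..}" by auto
      also have "prob \<dots> = prob {-x} + prob {-x<..}"
        by (rule finite_measure_Union) auto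
      also have "\<dots> = 1 - G m (-x)"
        by (simp add: 0 measure_G_greaterThan[OF assms])
      also have "\<dots> = cdf (interval_measure (G m)) x"
        by (simp add: cdf_G[OF assms] G_eq_tail)
      finally show "cdf (distr (interval_measure (G m)) borel uminus) x
          = cdf (interval_measure (G m)) x" .
    qed
  qed unfold_locales
qed

lemma measure_G_abs_greater:
  assumes "m > 0" "u \<ge> 0"
  shows "measure (interval_measure (G m)) {x. \<bar>x\<bar> > u} \<le> 2 * tail m u"
proof -
  interpret real_distribution "interval_measure (G m)" by (rule real_distribution_G[OF assms(1)])
  have "prob {x. \<bar>x\<bar> > u} \<le> prob ({..-u} \<union> {u<..})"
    by (intro finite_measure_mono) auto
  also have "\<dots> \<le> prob {..-u} + prob {u<..}"
    by (intro measure_Un_le) auto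
  also have "prob {..-u} = G m (-u)"
    using cdf_G[OF assms(1), THEN fun_cong, of "-u"] by (simp add: cdf_def)
  also have "prob {u<..} = 1 - G m u"
    by (rule measure_G_greaterThan[OF assms(1)])
  also have "G m (-u) + (1 - G m u) = 2 * tail m u"
    using assms(2) by (simp add: G_eq_tail tail_le_1)
  finally show ?thesis .
qed

section \<open>Moments of the heavy-tailed law\<close>

text \<open>The range of \<open>\<bar>x\<bar>\<close> above \<open>exp 1\<close> is cut at integer
  powers of \<open>e\<close>, and on each layer the \<open>m\<close>th power is bounded by its value
  at the outer edge. Base \<open>e\<close> turns the logarithm in the tail into an integer.\<close>

lemma powr_abs_le_layers:
  fixes m x :: real
  assumes "m > 0"
  shows "ennreal (\<bar>x\<bar> powr m) \<le> ennreal (exp m)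
      + (\<Sum>k. ennreal (exp (real (k + 2) * m)) * indicator {x. \<bar>x\<bar> > exp (real (k + 1))} x)"
    (is "_ \<le> _ + (\<Sum>k. ?f k)")
proof (cases "\<bar>x\<bar> \<le> exp 1")
  case True
  then have "\<bar>x\<bar> powr m \<le> exp 1 powr m" using assms by (intro powr_mono2) auto
  also have "\<dots> = exp m" by (simp add: powr_def)
  finally have "ennreal (\<bar>x\<bar> powr m) \<le> ennreal (exp m)" by (rule ennreal_leI)
  then show ?thesis by (rule add_increasing2[rotated]) simp
next
  case False
  then have pos: "\<bar>x\<bar> > 0"
    using exp_gt_zero[of 1] by linarith
  then have "exp 1 < exp (ln \<bar>x\<bar>)"
    using False by simp
  then have ln: "ln \<bar>x\<bar> > 1"
    by (simp only: exp_less_cancel_iff)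
  \<comment> \<open>The layer of \<open>x\<close> is given by
    \<open>k + 1 < ln \<bar>x\<bar> \<le> k + 2\<close>. Since \<open>ln \<bar>x\<bar> > 1\<close>,
    the ceiling is at least 2 and \<open>nat\<close> truncates nothing.\<close>
  define k where "k = nat (\<lceil>ln \<bar>x\<bar>\<rceil> - 2)"
  have "\<lceil>ln \<bar>x\<bar>\<rceil> \<ge> 2" using ln by linarith
  then have k: "real k = of_int \<lceil>ln \<bar>x\<bar>\<rceil> - 2" by (simp add: k_def)
  have "real (k + 1) < ln \<bar>x\<bar>" "ln \<bar>x\<bar> \<le> real (k + 2)"
    using k ceiling_correct[of "ln \<bar>x\<bar>"] by simp_all
  then have "exp (real (k + 1)) < exp (ln \<bar>x\<bar>)" "exp (ln \<bar>x\<bar>) \<le> exp (real (k + 2))"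
    by (simp_all only: exp_less_cancel_iff exp_le_cancel_iff)
  then have lower: "exp (real (k + 1)) < \<bar>x\<bar>" and upper: "\<bar>x\<bar> \<le> exp (real (k + 2))"
    using pos by simp_all
  have "\<bar>x\<bar> powr m \<le> exp (real (k + 2)) powr m"
    using upper assms by (intro powr_mono2) auto
  also have "\<dots> = exp (real (k + 2) * m)" by (simp add: powr_def mult.commute)
  finally have "ennreal (\<bar>x\<bar> powr m) \<le> ?f k"
    using lower by (simp add: ennreal_leI)
  also have "\<dots> = sum ?f {k}"
    by (simp only: sum.insert finite.emptyI empty_iff not_False_eq_True sum.empty add_0_right)
  also have "\<dots> \<le> (\<Sum>k. ?f k)"
    by (rule sum_le_suminf) (simp_all add: summableI)
  also have "\<dots> \<le> ennreal (exp m) + (\<Sum>k. ?f k)" by simp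
  finally show ?thesis .
qed

text \<open>The \<open>m\<close>th powers cancel up to the ratio \<open>exp m\<close> of the two
  layer edges. Only the squared logarithm survives, and it makes the layer sums converge at the
  critical exponent \<open>m\<close>.\<close>

lemma tail_exp:
  fixes k :: nat
  shows "exp (real (k + 2) * m) * (2 * tail m (exp (real (k + 1)))) = exp m * (1 / (real k + 1)\<^sup>2)"
proof -
  have "max (exp (real (k + 1))) 1 = exp (real (k + 1))" "max (real (k + 1)) 1 = real (k + 1)"
    by (simp_all add: max_absorb1)
  moreover have "exp (real (k + 1)) powr m = exp (real (k + 1) * m)"
    by (simp add: powr_def mult.commute)
  ultimately have "2 * tail m (exp (real (k + 1))) = 1 / (exp (real (k + 1) * m) * (real (k + 1))\<^sup>2)"
    by (simp only: tail_def ln_exp)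
  moreover have "exp (real (k + 2) * m) = exp m * exp (real (k + 1) * m)"
    by (simp add: exp_add[symmetric] algebra_simps)
  moreover have "real (k + 1) = real k + 1" by simp
  ultimately show ?thesis by simp
qed

text \<open>Integrating the layer bound term by term leaves multiples of the convergent series of
  inverse squares.\<close>

lemma integrable_G_powr:
  assumes "m > 0"
  shows "integrable (interval_measure (G m)) (\<lambda>x. \<bar>x\<bar> powr m)"
proof -
  interpret real_distribution "interval_measure (G m)" by (rule real_distribution_G[OF assms])
  let ?M = "interval_measure (G m)"
  let ?A = "\<lambda>k::nat. {x::real. \<bar>x\<bar> > exp (real (k + 1))}"
  have "summable (\<lambda>k. inverse (real (Suc k) ^ 2))"
    by (subst summable_Suc_iff) (rule inverse_power_summable, simp)
  moreover have "inverse (real (Suc k) ^ 2) = 1 / (real k + 1)\<^sup>2" for k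
    by (simp add: inverse_eq_divide add.commute)
  ultimately have sum: "summable (\<lambda>k. exp m * (1 / (real k + 1)\<^sup>2))"
    by (intro summable_mult) simp
  have "(\<integral>\<^sup>+x. ennreal (\<bar>x\<bar> powr m) \<partial>?M)
      \<le> (\<integral>\<^sup>+x. ennreal (exp m) + (\<Sum>k. ennreal (exp (real (k + 2) * m)) * indicator (?A k) x) \<partial>?M)"
    by (intro nn_integral_mono powr_abs_le_layers assms)
  also have "\<dots> = ennreal (exp m) + (\<Sum>k. ennreal (exp (real (k + 2) * m)) * emeasure ?M (?A k))"
  proof -
    have "(\<integral>\<^sup>+x. ennreal (exp m) \<partial>?M) = ennreal (exp m)"
      using emeasure_space_1 by simp
    moreover have "(\<integral>\<^sup>+x. (\<Sum>k. ennreal (exp (real (k + 2) * m)) * indicator (?A k) x) \<partial>?M)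
        = (\<Sum>k. ennreal (exp (real (k + 2) * m)) * emeasure ?M (?A k))"
      by (subst nn_integral_suminf) (auto simp: nn_integral_cmult_indicator)
    ultimately show ?thesis
      by (subst nn_integral_add) auto
  qed
  also have "\<dots> \<le> ennreal (exp m) + (\<Sum>k. ennreal (exp m * (1 / (real k + 1)\<^sup>2)))"
  proof (intro add_left_mono suminf_le summableI)
    fix k :: nat
    have "exp (real (k + 2) * m) * prob (?A k) \<le> exp (real (k + 2) * m) * (2 * tail m (exp (real (k + 1))))"
      by (intro mult_left_mono measure_G_abs_greater assms) auto
    then show "ennreal (exp (real (k + 2) * m)) * emeasure ?M (?A k) \<le> ennreal (exp m * (1 / (real k + 1)\<^sup>2))"
      unfolding emeasure_eq_measure tail_exp by (subst ennreal_mult'[symmetric]) (auto intro: ennreal_leI)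
  qed
  also have "\<dots> = ennreal (exp m) + ennreal (\<Sum>k. exp m * (1 / (real k + 1)\<^sup>2))"
    by (subst suminf_ennreal2[OF _ sum]) simp_all
  also have "\<dots> < \<infinity>" by simp
  finally show ?thesis
    by (intro integrableI_bounded) auto
qed

lemma integrable_G_square:
  assumes "m \<ge> 2"
  shows "integrable (interval_measure (G m)) (\<lambda>x. x\<^sup>2)"
proof -
  interpret real_distribution "interval_measure (G m)" using assms by (intro real_distribution_G) auto
  show ?thesis
  proof (rule Bochner_Integration.integrable_bound)
    show "integrable (interval_measure (G m)) (\<lambda>x. 1 + \<bar>x\<bar> powr m)"
      using integrable_G_powr[of m] assms by auto
    show "AE x in interval_measure (G m). norm (x\<^sup>2) \<le> norm (1 + \<bar>x\<bar> powr m)"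
    proof (rule AE_I2)
      fix x :: real
      show "norm (x\<^sup>2) \<le> norm (1 + \<bar>x\<bar> powr m)"
      proof (cases "\<bar>x\<bar> \<le> 1")
        case True
        then have "x\<^sup>2 \<le> 1" by (simp add: abs_square_le_1)
        moreover have "0 \<le> \<bar>x\<bar> powr m" by simp
        ultimately have "x\<^sup>2 \<le> 1 + \<bar>x\<bar> powr m" by linarith
        then show ?thesis by simp
      next
        case False
        then have "\<bar>x\<bar> powr 2 \<le> \<bar>x\<bar> powr m" using assms by (intro powr_mono) auto
        then show ?thesis using False by (simp add: powr_numeral)
      qed
    qed
  qed simp
qed

text \<open>\<open>G m\<close> is constant on \<open>[-1, 1]\<close>, so the open interval has no
  mass and the second moment is at least 1. This makes the square root positive and lets it be
  squared back.\<close>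

lemma sigma_props:
  assumes "m \<ge> 2"
  shows "sigma m > 0" "(sigma m)\<^sup>2 = (LINT x|interval_measure (G m). x\<^sup>2)"
proof -
  interpret real_distribution "interval_measure (G m)" using assms by (intro real_distribution_G) auto
  have "prob {x. \<bar>x\<bar> \<ge> 1} = 1"
  proof -
    have "prob {-1<..1} = G m 1 - G m (-1)"
      using cdf_diff_eq[of "-1" 1] cdf_G[of m] assms by simp
    also have "\<dots> = 0" by (simp add: G_eq_tail tail_le_1)
    finally have "prob {-1<..1} = 0" .
    moreover have "prob {-1<..<1} \<le> prob {-1<..1}"
      by (rule finite_measure_mono) auto
    ultimately have "prob {-1<..<1} = 0"
      by (simp add: measure_le_0_iff)
    moreover have "{x. \<bar>x\<bar> \<ge> 1} = UNIV - {-1<..<1::real}" by auto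
    ultimately show ?thesis using prob_compl[of "{-1<..<1}"] by simp
  qed
  moreover have "expectation (indicator {x. \<bar>x\<bar> \<ge> 1}) = prob {x. \<bar>x\<bar> \<ge> 1}"
    by (subst Bochner_Integration.integral_indicator) simp_all
  ultimately have "(1::real) = expectation (indicator {x. \<bar>x\<bar> \<ge> 1})" by simp
  also have "\<dots> \<le> (LINT x|interval_measure (G m). x\<^sup>2)"
  proof (intro integral_mono integrable_G_square assms)
    show "integrable (interval_measure (G m)) (indicator {x. \<bar>x\<bar> \<ge> 1} :: real \<Rightarrow> real)"
      by (intro integrable_real_indicator) (simp_all add: emeasure_eq_measure)
    show "indicator {x. \<bar>x\<bar> \<ge> 1} x \<le> x\<^sup>2" for x :: real
      using abs_le_square_iff[of 1 x] by (simp add: indicator_def)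
  qed
  finally have "1 \<le> (LINT x|interval_measure (G m). x\<^sup>2)" .
  then show "sigma m > 0" "(sigma m)\<^sup>2 = (LINT x|interval_measure (G m). x\<^sup>2)"
    by (auto simp: sigma_def)
qed

section \<open>The normalized law P\<close>

lemma real_distribution_P:
  assumes "m > 0"
  shows "real_distribution (P m)"
  unfolding P_def
proof -
  interpret real_distribution "interval_measure (G m)" by (rule real_distribution_G[OF assms])
  show "real_distribution (distr (interval_measure (G m)) borel ((*) (inverse (sigma m))))"
    by (rule real_distribution_distr) simp
qed

lemma symmetric_P:
  assumes "m > 0"
  shows "distr (P m) borel uminus = P m"
proof -
  interpret real_distribution "interval_measure (G m)" by (rule real_distribution_G[OF assms])
  have "distr (P m) borel uminus = distr (interval_measure (G m)) borel (\<lambda>x. inverse (sigma m) * (- x))"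
    unfolding P_def by (subst distr_distr) (auto simp: comp_def)
  also have "\<dots> = distr (distr (interval_measure (G m)) borel uminus) borel (\<lambda>x. inverse (sigma m) * x)"
    by (subst distr_distr) (auto simp: comp_def)
  finally show ?thesis by (simp add: symmetric_G[OF assms] P_def)
qed

lemma measure_P_greaterThan:
  assumes "m \<ge> 2" "t \<ge> 0"
  shows "measure (P m) {t<..} = tail m (sigma m * t)"
proof -
  interpret real_distribution "interval_measure (G m)" using assms by (intro real_distribution_G) auto
  have "t < inverse (sigma m) * x \<longleftrightarrow> sigma m * t < x" for x
    using sigma_props(1)[OF assms(1)] by (simp add: field_simps)
  then have "measure (P m) {t<..} = prob {sigma m * t<..}"
    unfolding P_def by (subst measure_distr) (simp_all add: vimage_def greaterThan_def)
  moreover have "tail m (- (sigma m * t)) = 1 / 2"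
    using assms(2) sigma_props(1)[OF assms(1)] by (intro tail_le_1) (smt (verit) mult_nonneg_nonneg)
  ultimately show ?thesis
    using assms by (simp add: measure_G_greaterThan G_eq_tail)
qed

lemma moments_P:
  assumes "m \<ge> 2"
  shows "integrable (P m) (\<lambda>x. x)" "(LINT x|P m. x) = 0"
    "integrable (P m) (\<lambda>x. x\<^sup>2)" "(LINT x|P m. x\<^sup>2) = 1"
    "integrable (P m) (\<lambda>x. \<bar>x\<bar> powr m)"
proof -
  have m: "m > 0" using assms by simp
  interpret G: real_distribution "interval_measure (G m)" by (rule real_distribution_G[OF m])
  interpret P: real_distribution "P m" by (rule real_distribution_P[OF m])
  have s: "sigma m > 0" by (rule sigma_props(1)[OF assms])
  show sq: "integrable (P m) (\<lambda>x. x\<^sup>2)"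
    unfolding P_def using integrable_G_square[OF assms]
    by (subst integrable_distr_eq) (auto simp: power_mult_distrib)
  show "integrable (P m) (\<lambda>x. x)"
    by (rule P.square_integrable_imp_integrable[OF _ sq]) simp
  \<comment> \<open>By symmetry the mean equals its own negative.\<close>
  have "(LINT x|P m. x) = (LINT x|distr (P m) borel uminus. x)"
    by (simp only: symmetric_P[OF m])
  also have "\<dots> = - (LINT x|P m. x)"
    by (subst integral_distr) simp_all
  finally show "(LINT x|P m. x) = 0" by simp
  have "(LINT x|P m. x\<^sup>2) = (inverse (sigma m))\<^sup>2 * (LINT x|interval_measure (G m). x\<^sup>2)"
    unfolding P_def by (subst integral_distr) (simp_all add: power_mult_distrib)
  then show "(LINT x|P m. x\<^sup>2) = 1"
    using s unfolding sigma_props(2)[OF assms, symmetric] by (simp add: power_inverse)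
  show "integrable (P m) (\<lambda>x. \<bar>x\<bar> powr m)"
    unfolding P_def using integrable_G_powr[OF m] s
    by (subst integrable_distr_eq) (simp_all add: abs_mult powr_mult)
qed

section \<open>Maxima of coordinates\<close>

lemma prob_std_gaussian_Max_gt:
  assumes "d \<ge> 1"
  shows "\<P>(z in std_gaussian d. Max (z ` {1..d}) > c) = 1 - cdf std_normal_distribution c ^ d"
proof -
  interpret N: real_distribution std_normal_distribution by (rule real_dist_normal_dist)
  interpret Z: prob_space "std_gaussian d"
    unfolding std_gaussian_def by (intro prob_space_PiM N.prob_space_axioms)
  have ne: "{1..d} \<noteq> {}" using assms by simp
  note coord = indep_vars_PiM_coordinates[OF N.prob_space_axioms N.events_eq_borel ne, folded std_gaussian_def]
  have "\<P>(z in std_gaussian d. Max ((\<lambda>j. z j) ` {1..d}) > c) = 1 - cdf std_normal_distribution c ^ card {1..d}"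
  proof (rule Z.prob_Max_gt[OF coord(1) ne])
    fix j assume j: "j \<in> {1..d}"
    have "(\<lambda>z. z j) \<in> borel_measurable (std_gaussian d)"
      using coord(1) j by (simp add: Z.indep_vars_def)
    then have "cdf (distr (std_gaussian d) borel (\<lambda>z. z j)) c = \<P>(z in std_gaussian d. z j \<le> c)"
      unfolding cdf_def by (subst measure_distr) (auto intro!: arg_cong[where f=Z.prob])
    then show "\<P>(z in std_gaussian d. z j \<le> c) = cdf std_normal_distribution c"
      by (simp only: coord(2)[OF j])
  qed simp
  then show ?thesis by simp
qed

text \<open>An entry is a measurable function of its row, so a column inherits independence from the
  rows.\<close>

lemma iid_vectors_column:
  assumes M: "prob_space M" and X: "iid_vectors_with_indep_entries M Q n d X" and j: "j \<in> {1..d}"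
  shows "prob_space.indep_vars M (\<lambda>_. borel) (\<lambda>i. X i j) {1..n}"
    and "i \<in> {1..n} \<Longrightarrow> distr M borel (X i j) = Q"
proof -
  interpret prob_space M by fact
  have "indep_vars (\<lambda>_. Pi\<^sub>M {1..d} (\<lambda>_. borel)) (\<lambda>i \<omega>. \<lambda>j\<in>{1..d}. X i j \<omega>) {1..n}"
    using X by (simp add: iid_vectors_with_indep_entries_def)
  then have "indep_vars (\<lambda>_. borel) (\<lambda>i \<omega>. (\<lambda>j\<in>{1..d}. X i j \<omega>) j) {1..n}"
    by (rule indep_vars_compose2) (use j in simp)
  then show "indep_vars (\<lambda>_. borel) (\<lambda>i. X i j) {1..n}"
    using j by simp
  show "i \<in> {1..n} \<Longrightarrow> distr M borel (X i j) = Q"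
    using X j by (simp add: iid_vectors_with_indep_entries_def)
qed

text \<open>All entries are jointly independent, and the columns use disjoint blocks of them, so the
  coordinates of the normalized sum are independent. Each has the law of coordinate 1, hence the
  \<open>d\<close>th power.\<close>

lemma prob_iid_vectors_Max_gt:
  assumes M: "prob_space M" and X: "iid_vectors_with_indep_entries M Q n d X"
    and n: "n \<ge> 1" and d: "d \<ge> 1"
  shows "\<P>(\<omega> in M. Max (normalized_sum n (\<lambda>i j. X i j \<omega>) ` {1..d}) > c)
    = 1 - \<P>(\<omega> in M. normalized_sum n (\<lambda>i j. X i j \<omega>) 1 \<le> c) ^ d"
proof -
  interpret prob_space M by fact
  let ?S = "\<lambda>j \<omega>. normalized_sum n (\<lambda>i j. X i j \<omega>) j"
  have "indep_vars (\<lambda>_. borel) (\<lambda>(i, j). X i j) ({1..n} \<times> {1..d})"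
    using X n d by (intro indep_vars_rows_imp_indep_entries)
      (auto simp: iid_vectors_with_indep_entries_def)
  then have "indep_vars (\<lambda>j. Pi\<^sub>M ({1..n} \<times> {j}) (\<lambda>_. borel))
      (\<lambda>j \<omega>. restrict (\<lambda>p. (case p of (i, j) \<Rightarrow> X i j) \<omega>) ({1..n} \<times> {j})) {1..d}"
    by (rule indep_vars_restrict) (auto simp: disjoint_family_on_def)
  then have "indep_vars (\<lambda>_. borel) (\<lambda>j \<omega>. (\<lambda>f. real n powr (-1/2) * (\<Sum>i=1..n. f (i, j)))
      (restrict (\<lambda>p. (case p of (i, j) \<Rightarrow> X i j) \<omega>) ({1..n} \<times> {j}))) {1..d}"
  proof (rule indep_vars_compose2)
    show "(\<lambda>f. real n powr (-1/2) * (\<Sum>i=1..n. f (i, j)))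
        \<in> borel_measurable (Pi\<^sub>M ({1..n} \<times> {j}) (\<lambda>_. borel))" for j
      by (intro borel_measurable_times borel_measurable_const borel_measurable_sum
          measurable_component_singleton) auto
  qed
  then have ind: "indep_vars (\<lambda>_. borel) ?S {1..d}"
    by (simp add: normalized_sum_def)
  have "\<P>(\<omega> in M. Max ((\<lambda>j. ?S j \<omega>) ` {1..d}) > c) = 1 - \<P>(\<omega> in M. ?S 1 \<omega> \<le> c) ^ card {1..d}"
  proof (rule prob_Max_gt[OF ind])
    fix j assume j: "j \<in> {1..d}"
    have law: "\<P>(\<omega> in M. ?S j \<omega> \<le> c)
        = measure (distr M borel (\<lambda>\<omega>. \<Sum>i=1..n. X i j \<omega>)) {s. real n powr (-1/2) * s \<le> c}"
      if j: "j \<in> {1..d}" for j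
    proof -
      have "(\<lambda>\<omega>. \<Sum>i=1..n. X i j \<omega>) \<in> borel_measurable M"
        using iid_vectors_column(1)[OF M X j] by (intro borel_measurable_sum) (auto simp: indep_vars_def)
      then show ?thesis
        by (subst measure_distr) (auto intro!: arg_cong[where f=prob] simp: normalized_sum_def)
    qed
    have one: "1 \<in> {1..d}" using d by simp
    have "distr M borel (\<lambda>\<omega>. \<Sum>i=1..n. X i j \<omega>) = distr M borel (\<lambda>\<omega>. \<Sum>i=1..n. X i 1 \<omega>)"
      by (rule distr_sum_iid_eq[OF M M iid_vectors_column(1)[OF M X j] iid_vectors_column(1)[OF M X one]
          iid_vectors_column(2)[OF M X j] iid_vectors_column(2)[OF M X one] refl])
    then show "\<P>(\<omega> in M. ?S j \<omega> \<le> c) = \<P>(\<omega> in M. ?S 1 \<omega> \<le> c)"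
      by (simp only: law[OF j] law[OF one])
  qed (use d in auto)
  then show ?thesis by simp
qed

section \<open>Gaussian quantiles and tails of normalized sums\<close>

text \<open>Bernoulli's inequality bounds the exceedance probability by \<open>d\<close> times the
  one-dimensional tail, which the exponential bound controls; solving for \<open>c\<close> gives the
  claim. The level is \<alpha>/2 because the exceedance probabilities only converge to \<alpha>, and
  so are above \<alpha>/2 for large \<open>d\<close>.\<close>

lemma std_gaussian_quantile_le:
  assumes d: "d \<ge> 1" and \<alpha>: "0 < \<alpha>" "\<alpha> \<le> 1"
    and le: "\<alpha> / 2 \<le> \<P>(z in std_gaussian d. Max (z ` {1..d}) > c)"
  shows "c \<le> sqrt (2 * ln (2 * real d / \<alpha>))"
proof (cases "c \<le> 0")
  case True
  \<comment> \<open>The logarithm is then nonnegative, so the square root dominates every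
    \<open>c \<le> 0\<close>.\<close>
  have "1 \<le> 2 * real d / \<alpha>" using d \<alpha> by (simp add: field_simps)
  then show ?thesis using True by (meson ln_ge_zero mult_nonneg_nonneg order_trans real_sqrt_ge_zero zero_le_numeral)
next
  case False
  interpret N: real_distribution std_normal_distribution by (rule real_dist_normal_dist)
  let ?F = "cdf std_normal_distribution c"
  have "1 + real d * (?F - 1) \<le> (1 + (?F - 1)) ^ d"
    using N.cdf_nonneg[of c] by (intro Bernoulli_inequality) simp
  then have "\<alpha> / 2 \<le> real d * (1 - ?F)"
    using le prob_std_gaussian_Max_gt[OF d, of c] by (simp add: algebra_simps)
  also have "\<dots> \<le> real d * exp (- c\<^sup>2 / 2)"
    using False by (intro mult_left_mono std_normal_tail_le) auto
  finally have "exp (c\<^sup>2 / 2) \<le> 2 * real d / \<alpha>"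
    using \<alpha> by (simp add: exp_minus field_simps)
  then have "c\<^sup>2 / 2 \<le> ln (2 * real d / \<alpha>)"
    using d \<alpha> by (subst ln_ge_iff) auto
  then show ?thesis
    by (intro real_le_rsqrt) simp
qed

text \<open>One big jump above \<open>sqrt n * x\<close>: when \<open>n\<close> times the tail
  probability is at most 1/4, the factor 1/2 minus that product is at least 1/4.\<close>

lemma P_sum_tail_ge:
  fixes X :: "nat \<Rightarrow> 'a \<Rightarrow> real"
  assumes M: "prob_space M" and X: "prob_space.indep_vars M (\<lambda>_. borel) X {1..n}"
    and dX: "\<And>i. i \<in> {1..n} \<Longrightarrow> distr M borel (X i) = P m"
    and m: "m \<ge> 2" and n: "n \<ge> 1" and x: "x \<ge> 0"
    and small: "real n * tail m (sigma m * (sqrt (real n) * x)) \<le> 1 / 4"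
  shows "\<P>(\<omega> in M. real n powr (-1/2) * (\<Sum>i=1..n. X i \<omega>) > x)
    \<ge> real n * tail m (sigma m * (sqrt (real n) * x)) / 4"
proof -
  interpret prob_space M by fact
  let ?t = "sqrt (real n) * x"
  let ?p = "tail m (sigma m * ?t)"
  have p: "measure (P m) {?t<..} = ?p"
    using m x by (intro measure_P_greaterThan) auto
  have sym: "distr (P m) borel uminus = P m" using m by (intro symmetric_P) simp
  have "real n powr (-1/2) = 1 / sqrt (real n)"
    using powr_minus_divide[of "real n" "1/2"] by (simp add: powr_half_sqrt)
  then have "real n powr (-1/2) * s > x \<longleftrightarrow> s > ?t" for s
    using n by (simp add: pos_less_divide_eq mult.commute)
  then have "\<P>(\<omega> in M. real n powr (-1/2) * (\<Sum>i=1..n. X i \<omega>) > x) = \<P>(\<omega> in M. (\<Sum>i=1..n. X i \<omega>) > ?t)"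
    by simp
  also have "\<dots> \<ge> real n * ?p * (1 / 2 - real n * ?p)"
    using symmetric_sum_tail_ge[OF _ X dX sym, of ?t] by (simp add: p)
  moreover have "real n * ?p * (1 / 4) \<le> real n * ?p * (1 / 2 - real n * ?p)"
    using small tail_nonneg[of m] by (intro mult_left_mono mult_nonneg_nonneg) auto
  ultimately show ?thesis by simp
qed

text \<open>The logarithmic factor is at least 1 and is dropped. For \<open>m > 2\<close> the bound
  tends to zero, which supplies the smallness condition for the one big jump.\<close>

lemma n_tail_le:
  assumes "m > 0" "n \<ge> 1" "y \<ge> 1"
  shows "real n * tail m (sqrt (real n) * y) \<le> real n powr (1 - m / 2) / 2"
proof -
  have "tail m (sqrt (real n) * y) \<le> tail m (sqrt (real n))"
    using assms mult_left_mono[of 1 y "sqrt (real n)"] by (intro tail_antimono) auto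
  also have "\<dots> = 1 / 2 * (1 / (sqrt (real n) powr m * (max (ln (sqrt (real n))) 1)\<^sup>2))"
    using assms by (simp add: tail_def max_absorb1)
  also have "\<dots> \<le> 1 / 2 * (1 / (sqrt (real n) powr m * 1))"
    using assms by (intro mult_left_mono divide_left_mono mult_pos_pos one_le_power) auto
  also have "sqrt (real n) powr m = real n powr (m / 2)"
    using assms by (simp add: powr_half_sqrt[symmetric] powr_powr)
  finally have "real n * tail m (sqrt (real n) * y) \<le> real n * (1 / 2 * (1 / (real n powr (m / 2) * 1)))"
    by (intro mult_left_mono) auto
  also have "\<dots> = real n powr (1 - m / 2) / 2"
    using assms by (simp add: powr_diff)
  finally show ?thesis .
qed

text \<open>Here \<open>n\<close> is known only through an upper bound \<open>N\<close>. As
  \<open>m \<ge> 2\<close>, the power of \<open>n\<close> is nonincreasing, and the logarithm in the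
  denominator is nondecreasing, so replacing \<open>n\<close> by \<open>N\<close> can only lower the
  right-hand side.\<close>

lemma n_tail_ge:
  fixes n s x N m :: real
  assumes m: "m \<ge> 2" and n: "n \<ge> 1" "n \<le> N" and s: "s > 0" "x > 0" "s * x \<ge> 1"
  shows "n * tail m (s * (sqrt n * x))
     \<ge> 1 / 2 * N powr (1 - m / 2) / (s powr m * x powr m * (max (ln (s * sqrt N * x)) 1)\<^sup>2)"
proof -
  let ?u = "s * (sqrt n * x)"
  \<comment> \<open>The argument of the tail reaches 1, so its cut-off is inactive and the explicit
    formula holds.\<close>
  have "1 * 1 \<le> (s * x) * sqrt n" using n s by (intro mult_mono) auto
  then have u: "?u \<ge> 1" by (simp add: mult_ac)
  have um: "?u powr m = s powr m * x powr m * n powr (m / 2)"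
    using n s by (simp add: powr_mult powr_half_sqrt[symmetric] powr_powr)
  have "n * tail m ?u = 1 / 2 * n powr (1 - m / 2) / (s powr m * x powr m * (max (ln ?u) 1)\<^sup>2)"
  proof -
    have "n powr (1 - m / 2) = n / n powr (m / 2)" using n by (simp add: powr_diff)
    then show ?thesis unfolding tail_def max_absorb1[OF u] um by (simp add: mult_ac)
  qed
  moreover have "N powr (1 - m / 2) \<le> n powr (1 - m / 2)"
    using m n by (intro powr_mono2') auto
  moreover have "ln ?u \<le> ln (s * sqrt N * x)"
  proof -
    have "?u \<le> s * sqrt N * x" using n s by simp
    then show ?thesis using u by (intro ln_mono) auto
  qed
  then have "(max (ln ?u) 1)\<^sup>2 \<le> (max (ln (s * sqrt N * x)) 1)\<^sup>2"
    by (intro power_mono max.mono) auto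
  ultimately show ?thesis
    using s by (auto intro!: frac_le mult_left_mono mult_pos_pos simp del: mult_le_cancel_left_pos)
qed

section \<open>Asymptotics\<close>

text \<open>This is \<open>d\<close> times the bound of \<open>n_tail_ge\<close>, with
  \<open>N\<close> a power of \<open>d / \<delta>\<close> and \<open>x\<close> the Gaussian quantile
  bound. The factor \<open>d powr (1 + \<theta>)\<close> has a positive exponent and beats the
  powers of logarithms in the denominator.\<close>

lemma dimension_tail_at_top:
  fixes \<theta> \<kappa> \<delta> \<alpha> s m :: real
  assumes "\<theta> > -1" "\<kappa> > 0" "\<delta> > 0" "\<alpha> > 0" "s > 0" "m > 0"
  shows "filterlim (\<lambda>d. d / 2 * (d / \<delta>) powr \<theta> / (s powr m * sqrt (2 * ln (2 * d / \<alpha>)) powr m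
     * (max (ln (s * (d / \<delta>) powr \<kappa> * sqrt (2 * ln (2 * d / \<alpha>)))) 1)\<^sup>2)) at_top at_top"
  using assms by real_asymp

text \<open>No growth of \<open>d n\<close> is assumed, so the dimensions are split at a threshold
  \<open>D\<close>. Above it, the power of \<open>F\<close> is dropped as nonnegative and the
  Gaussian probability exceeds \<open>\<alpha> - e\<close>. Below it, only finitely many levels
  \<open>c k\<close> occur, and pointwise convergence is uniform over them.\<close>

lemma eventually_diff_le:
  fixes F :: "nat \<Rightarrow> real \<Rightarrow> real" and c :: "nat \<Rightarrow> real" and d :: "nat \<Rightarrow> nat"
  assumes lim: "(\<lambda>k. 1 - \<Phi> (c k) ^ k) \<longlonglongrightarrow> \<alpha>" and \<alpha>: "\<alpha> < 1"
    and F: "\<And>x. (\<lambda>n. F n x) \<longlonglongrightarrow> \<Phi> x" and F0: "\<And>n x. n \<ge> 1 \<Longrightarrow> F n x \<ge> 0" and e: "e > (0::real)"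
  shows "eventually (\<lambda>n. (1 - F n (c (d n)) ^ d n) - (1 - \<Phi> (c (d n)) ^ d n) \<le> 1 - \<alpha> + e) sequentially"
proof -
  obtain D where D: "\<And>k. k \<ge> D \<Longrightarrow> 1 - \<Phi> (c k) ^ k > \<alpha> - e"
    using order_tendstoD(1)[OF lim, of "\<alpha> - e"] e by (auto simp: eventually_sequentially)
  have "eventually (\<lambda>n. \<forall>k\<in>{..<D}. F n (c k) ^ k > \<Phi> (c k) ^ k - e) sequentially"
  proof (rule eventually_ball_finite)
    show "\<forall>k\<in>{..<D}. eventually (\<lambda>n. F n (c k) ^ k > \<Phi> (c k) ^ k - e) sequentially"
      using e by (intro ballI order_tendstoD(1)[OF tendsto_power[OF F]]) simp
  qed simp
  then show ?thesis
    using eventually_ge_at_top[of 1]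
  proof eventually_elim
    case (elim n)
    show ?case
    proof (cases "d n < D")
      case True
      then have "F n (c (d n)) ^ d n > \<Phi> (c (d n)) ^ d n - e" using elim(1) by blast
      then show ?thesis using \<alpha> by linarith
    next
      case False
      then show ?thesis using D[of "d n"] zero_le_power[OF F0[OF elim(2)], of "c (d n)" "d n"] by simp
    qed
  qed
qed

lemma power_one_minus_le_exp:
  fixes q :: real
  assumes "q \<le> 1"
  shows "(1 - q) ^ k \<le> exp (- (real k * q))"
proof -
  have "(1 - q) ^ k \<le> exp (- q) ^ k"
    using assms exp_ge_add_one_self[of "-q"] by (intro power_mono) auto
  also have "\<dots> = exp (- (real k * q))" by (simp add: exp_of_nat_mult[symmetric])
  finally show ?thesis .
qed

text \<open>Only \<open>d n \<ge> \<delta> n powr \<beta>\<close> is known, so \<open>n\<close> is eliminated in favour of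
  \<open>d n\<close>, which may be arbitrarily large: all bounds below depend on \<open>d n\<close> alone.\<close>

lemma eventually_prob_iid_vectors_Max_gt_ge:
  fixes X :: "nat \<Rightarrow> nat \<Rightarrow> nat \<Rightarrow> 'a \<Rightarrow> real"
  assumes m: "m > 2" and \<alpha>: "0 < \<alpha>" "\<alpha> < 1" and \<epsilon>: "\<epsilon> > 0" and \<delta>: "\<delta> > 0" and e: "e > 0"
    and c: "(\<lambda>d. \<P>(z in std_gaussian d. Max (z ` {1..d}) > c d)) \<longlonglongrightarrow> \<alpha>"
    and MX: "\<And>n. n \<ge> 1 \<Longrightarrow> d n \<ge> 1 \<and> prob_space (M n) \<and> iid_vectors_with_indep_entries (M n) (P m) n (d n) (X n)"
  shows "eventually (\<lambda>n. \<delta> * real n powr (m/2 - 1 + \<epsilon>) \<le> real (d n) \<longrightarrow>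
      \<P>(\<omega> in M n. Max (normalized_sum n (\<lambda>i j. X n i j \<omega>) ` {1..d n}) > c (d n))
        - \<P>(z in std_gaussian (d n). Max (z ` {1..d n}) > c (d n)) \<ge> 1 - \<alpha> - e) sequentially"
proof -
  \<comment> \<open>With \<open>n \<le> N = (d / \<delta>) powr (1 / \<beta>)\<close>, the power
    \<open>N powr (1 - m/2)\<close> becomes \<open>(d / \<delta>) powr \<theta>\<close> and
    \<open>sqrt N\<close> becomes \<open>(d / \<delta>) powr \<kappa>\<close>. The inequality
    \<open>\<theta> > -1\<close> says \<open>m/2 - 1 < \<beta>\<close>, which is where
    \<open>\<epsilon> > 0\<close> enters.\<close>
  define \<beta> where "\<beta> = m/2 - 1 + \<epsilon>"
  have \<beta>: "\<beta> > 0" using m \<epsilon> by (simp add: \<beta>_def)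
  define \<theta> where "\<theta> = (1 - m/2) / \<beta>"
  define \<kappa> where "\<kappa> = 1 / (2 * \<beta>)"
  have \<theta>: "\<theta> > -1" and \<kappa>: "\<kappa> > 0" using \<beta> \<epsilon> by (auto simp: \<theta>_def \<kappa>_def \<beta>_def field_simps)
  let ?s = "sigma m"
  have s: "?s > 0" using m by (intro sigma_props) simp
  define b where "b x = sqrt (2 * ln (2 * x / \<alpha>))" for x
  define H where "H x = x / 2 * (x / \<delta>) powr \<theta> / (?s powr m * b x powr m
     * (max (ln (?s * (x / \<delta>) powr \<kappa> * b x)) 1)\<^sup>2)" for x
  \<comment> \<open>Chosen so that \<open>exp (- (K / 4)) = e / 2\<close>; the 4 offsets the factor
    1/4 in \<open>P_sum_tail_ge\<close>.\<close>
  define K where "K = - 4 * ln (e / 2)"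
  have "eventually (\<lambda>x. H x \<ge> K) at_top"
    using dimension_tail_at_top[OF \<theta> \<kappa> \<delta> \<alpha>(1) s, of m] m by (simp add: H_def b_def filterlim_at_top)
  moreover have "eventually (\<lambda>x. ?s * b x \<ge> 1) at_top"
  proof -
    have "filterlim (\<lambda>x. ?s * b x) at_top at_top"
      unfolding b_def using s \<alpha>(1) by real_asymp
    then show ?thesis by (simp add: filterlim_at_top)
  qed
  ultimately have "eventually (\<lambda>x. H x \<ge> K \<and> ?s * b x \<ge> 1) at_top"
    by eventually_elim simp
  then obtain D1 where D1: "\<And>x. x \<ge> D1 \<Longrightarrow> H x \<ge> K \<and> ?s * b x \<ge> 1"
    by (auto simp: eventually_at_top_linorder)
  let ?Z = "\<lambda>k. \<P>(z in std_gaussian k. Max (z ` {1..k}) > c k)"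
  have "eventually (\<lambda>k. \<alpha> / 2 < ?Z k \<and> ?Z k < \<alpha> + e / 2) sequentially"
    using \<alpha> e by (intro eventually_conj order_tendstoD[OF c]) auto
  then obtain D2 where D2: "\<And>k. k \<ge> D2 \<Longrightarrow> \<alpha> / 2 < ?Z k \<and> ?Z k < \<alpha> + e / 2"
    by (auto simp: eventually_sequentially)
  \<comment> \<open>The lower bound on \<open>d n\<close> tends to infinity, so for large
    \<open>n\<close> every admissible \<open>d n\<close> is past both thresholds \<open>D1\<close>
    and \<open>D2\<close>.\<close>
  have "filterlim (\<lambda>n. \<delta> * real n powr \<beta>) at_top sequentially"
    using \<delta> \<beta> by real_asymp
  then have "eventually (\<lambda>n. \<delta> * real n powr \<beta> \<ge> max D1 (real D2)) sequentially"
    by (simp only: filterlim_at_top)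
  moreover have "((\<lambda>n. real n powr (1 - m/2) / 2) \<longlongrightarrow> 0) sequentially"
    using m by real_asymp
  then have "eventually (\<lambda>n. real n powr (1 - m/2) / 2 < 1 / 4) sequentially"
    by (rule order_tendstoD) simp
  ultimately show ?thesis
    using eventually_ge_at_top[of 1]
  proof eventually_elim
    case (elim n)
    show ?case
    proof
      assume dn: "\<delta> * real n powr (m/2 - 1 + \<epsilon>) \<le> real (d n)"
      let ?k = "d n"
      have k: "?k \<ge> 1" and M: "prob_space (M n)" and X: "iid_vectors_with_indep_entries (M n) (P m) n ?k (X n)"
        using MX elim(3) by auto
      interpret prob_space "M n" by (rule M)
      have dn': "\<delta> * real n powr \<beta> \<le> real ?k" using dn by (simp add: \<beta>_def)
      have HK: "H ?k \<ge> K" and sb: "?s * b ?k \<ge> 1"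
        using D1[of "real ?k"] dn' elim(1) by auto
      have "D2 \<le> ?k" using dn' elim(1) by simp
      then have Z: "\<alpha> / 2 < ?Z ?k" "?Z ?k < \<alpha> + e / 2" using D2 by auto
      have cb: "c ?k \<le> b ?k"
        unfolding b_def using Z(1) \<alpha> by (intro std_gaussian_quantile_le[OF k]) auto
      have b0: "b ?k > 0" using sb s by (smt (verit) mult_nonneg_nonpos)
      define N where "N = (real ?k / \<delta>) powr (1 / \<beta>)"
      have "real n \<le> N"
      proof -
        have "real n = (real n powr \<beta>) powr (1 / \<beta>)"
          using \<beta> elim(3) by (simp add: powr_powr)
        also have "\<dots> \<le> N"
          unfolding N_def using dn' \<delta> \<beta> by (intro powr_mono2) (auto simp: field_simps)
        finally show ?thesis .
      qed
      let ?p = "tail m (?s * (sqrt (real n) * b ?k))"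
      have "1 / 2 * N powr (1 - m / 2) / (?s powr m * b ?k powr m * (max (ln (?s * sqrt N * b ?k)) 1)\<^sup>2)
          \<le> real n * ?p"
        using m elim(3) s b0 sb \<open>real n \<le> N\<close> by (intro n_tail_ge) auto
      moreover have "N powr (1 - m / 2) = (real ?k / \<delta>) powr \<theta>" "sqrt N = (real ?k / \<delta>) powr \<kappa>"
        by (simp_all add: N_def \<theta>_def \<kappa>_def powr_powr powr_half_sqrt[symmetric] mult.commute)
      ultimately have "real ?k * (1 / 2 * (real ?k / \<delta>) powr \<theta>
          / (?s powr m * b ?k powr m * (max (ln (?s * (real ?k / \<delta>) powr \<kappa> * b ?k)) 1)\<^sup>2))
          \<le> real ?k * (real n * ?p)"
        by (intro mult_left_mono) simp_all
      then have Hp: "K \<le> real ?k * (real n * ?p)"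
        using HK by (simp add: H_def)
      have "real n * ?p = real n * tail m (sqrt (real n) * (?s * b ?k))"
        by (simp add: mult_ac)
      also have "\<dots> \<le> real n powr (1 - m / 2) / 2"
        using m elim(3) sb by (intro n_tail_le) auto
      finally have small: "real n * ?p \<le> 1 / 4" using elim(2) by simp
      have one: "1 \<in> {1..?k}" using k by simp
      let ?S = "\<lambda>\<omega>. normalized_sum n (\<lambda>i j. X n i j \<omega>) 1"
      have mS: "?S \<in> borel_measurable (M n)"
        using iid_vectors_column(1)[OF M X one] unfolding normalized_sum_def
        by (intro borel_measurable_times borel_measurable_const borel_measurable_sum) (auto simp: indep_vars_def)
      have "real n * ?p / 4 \<le> \<P>(\<omega> in M n. ?S \<omega> > b ?k)"
        unfolding normalized_sum_def using m elim(3) b0 small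
        by (intro P_sum_tail_ge M iid_vectors_column[OF M X one]) auto
      \<comment> \<open>The jump is estimated at the explicit level \<open>b ?k\<close>, which lies
        above \<open>c ?k\<close>.\<close>
      also have "\<dots> \<le> \<P>(\<omega> in M n. ?S \<omega> > c ?k)"
        using cb mS by (intro finite_measure_mono) auto
      finally have q: "real n * ?p / 4 \<le> \<P>(\<omega> in M n. ?S \<omega> > c ?k)" .
      have "{\<omega> \<in> space (M n). ?S \<omega> \<le> c ?k} = space (M n) - {\<omega> \<in> space (M n). ?S \<omega> > c ?k}" by auto
      then have F: "\<P>(\<omega> in M n. ?S \<omega> \<le> c ?k) = 1 - \<P>(\<omega> in M n. ?S \<omega> > c ?k)"
        using mS by (simp add: prob_compl)
      have "\<P>(\<omega> in M n. ?S \<omega> \<le> c ?k) ^ ?k \<le> exp (- (real ?k * \<P>(\<omega> in M n. ?S \<omega> > c ?k)))"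
        unfolding F by (rule power_one_minus_le_exp) simp
      also have "\<dots> \<le> exp (- (K / 4))"
        using Hp mult_left_mono[OF q, of "real ?k"] by simp
      \<comment> \<open>The other half of \<open>e\<close> is the deviation of the Gaussian
        probability from \<alpha>.\<close>
      also have "\<dots> = e / 2" using e by (simp add: K_def)
      finally show "prob {\<omega> \<in> space (M n). Max (normalized_sum n (\<lambda>i j. X n i j \<omega>) ` {1..?k}) > c ?k} - ?Z ?k \<ge> 1 - \<alpha> - e"
        using Z(2) prob_iid_vectors_Max_gt[OF M X elim(3) k, of "c ?k"] by simp
    qed
  qed
qed

section \<open>Upper limits and conclusion\<close>

lemma frequently_gt_of_limsup_pos:
  fixes f :: "nat \<Rightarrow> real"
  assumes "limsup (\<lambda>n. ereal (f n)) > 0"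
  obtains \<delta> where "\<delta> > 0" "frequently (\<lambda>n. f n > \<delta>) sequentially"
proof -
  obtain \<delta> where \<delta>: "0 < ereal \<delta>" "ereal \<delta> < limsup (\<lambda>n. ereal (f n))"
    using ereal_dense2[OF assms] by auto
  have "frequently (\<lambda>n. f n > \<delta>) sequentially"
  proof (rule ccontr)
    assume "\<not> frequently (\<lambda>n. f n > \<delta>) sequentially"
    then have "eventually (\<lambda>n. ereal (f n) \<le> ereal \<delta>) sequentially"
      by (simp add: not_frequently not_less)
    then have "limsup (\<lambda>n. ereal (f n)) \<le> ereal \<delta>" by (rule Limsup_bounded)
    then show False using \<delta> by simp
  qed
  then show ?thesis using that \<delta> by simp
qed

text \<open>The upper estimate must hold eventually, the lower one only infinitely often. This
  matches the growth condition on \<open>d\<close>, which yields large dimensions along a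
  subsequence only.\<close>

lemma limsup_eqI:
  fixes f :: "nat \<Rightarrow> real"
  assumes upper: "\<And>e. e > 0 \<Longrightarrow> eventually (\<lambda>n. f n \<le> a + e) sequentially"
    and lower: "\<And>e. e > 0 \<Longrightarrow> frequently (\<lambda>n. f n \<ge> a - e) sequentially"
  shows "limsup (\<lambda>n. ereal (f n)) = ereal a"
proof (rule antisym)
  show "limsup (\<lambda>n. ereal (f n)) \<le> ereal a"
  proof (rule ereal_le_epsilon2)
    show "limsup (\<lambda>n. ereal (f n)) \<le> ereal a + ereal e" if "e > 0" for e
      using upper[OF that] by (intro Limsup_bounded) simp
  qed
  show "ereal a \<le> limsup (\<lambda>n. ereal (f n))"
  proof (rule ccontr)
    assume "\<not> ereal a \<le> limsup (\<lambda>n. ereal (f n))"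
    then obtain r where r: "limsup (\<lambda>n. ereal (f n)) < ereal r" "ereal r < ereal a"
      using ereal_dense2[of "limsup (\<lambda>n. ereal (f n))" "ereal a"] by (auto simp: not_le)
    have "eventually (\<lambda>n. f n < r) sequentially"
      using Limsup_lessD[OF r(1)] by simp
    moreover have "frequently (\<lambda>n. f n \<ge> r) sequentially"
      using lower[of "a - r"] r(2) by simp
    ultimately show False
      by (simp add: frequently_def not_le)
  qed
qed

theorem theorem2p1:
  fixes m \<alpha> :: real and c :: "nat \<Rightarrow> real"
  assumes "m > 2" and "0 < \<alpha>" and "\<alpha> < 1"
    and "(\<lambda>d. \<P>(z in std_gaussian d. Max (z ` {1..d}) > c d)) \<longlonglongrightarrow> \<alpha>"
  shows "prob_space (P m) \<and> sets (P m) = sets borel \<and>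
    integrable (P m) (\<lambda>x. x) \<and> prob_space.expectation (P m) (\<lambda>x. x) = 0 \<and>
    integrable (P m) (\<lambda>x. x\<^sup>2) \<and> prob_space.variance (P m) (\<lambda>x. x) = 1 \<and>
    integrable (P m) (\<lambda>x. \<bar>x\<bar> powr m) \<and>
    (\<forall>(d :: nat \<Rightarrow> nat) (M :: nat \<Rightarrow> 'a measure) (X :: nat \<Rightarrow> nat \<Rightarrow> nat \<Rightarrow> 'a \<Rightarrow> real).
      (\<forall>n\<ge>1. d n \<ge> 1 \<and> prob_space (M n) \<and> iid_vectors_with_indep_entries (M n) (P m) n (d n) (X n)) \<longrightarrow>
      (\<exists>\<epsilon>>0. limsup (\<lambda>n. ereal (real (d n) / real n powr (m/2 - 1 + \<epsilon>))) > 0) \<longrightarrow>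
      limsup (\<lambda>n. ereal (
          \<P>(\<omega> in M n. Max (normalized_sum n (\<lambda>i j. X n i j \<omega>) ` {1..d n}) > c (d n))
        - \<P>(z in std_gaussian (d n). Max (z ` {1..d n}) > c (d n))))
      = ereal (1 - \<alpha>))"
proof -
  interpret P: real_distribution "P m" using assms by (intro real_distribution_P) simp
  have m: "m \<ge> 2" using assms by simp
  note mom = moments_P[OF m]
  have main: "limsup (\<lambda>n. ereal (
          \<P>(\<omega> in M n. Max (normalized_sum n (\<lambda>i j. X n i j \<omega>) ` {1..d n}) > c (d n))
        - \<P>(z in std_gaussian (d n). Max (z ` {1..d n}) > c (d n))))
      = ereal (1 - \<alpha>)"
    if MX: "\<And>n. n \<ge> 1 \<Longrightarrow> d n \<ge> 1 \<and> prob_space (M n) \<and> iid_vectors_with_indep_entries (M n) (P m) n (d n) (X n)"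
      and \<epsilon>: "\<epsilon> > 0" "limsup (\<lambda>n. ereal (real (d n) / real n powr (m/2 - 1 + \<epsilon>))) > 0"
    for d :: "nat \<Rightarrow> nat" and M :: "nat \<Rightarrow> 'a measure" and X \<epsilon>
  proof (rule limsup_eqI)
    fix e :: real assume e: "e > 0"
    let ?\<Phi> = "cdf std_normal_distribution"
    let ?F = "\<lambda>n x. \<P>(\<omega> in M n. normalized_sum n (\<lambda>i j. X n i j \<omega>) 1 \<le> x)"
    have one: "1 \<in> {1..d n}" if "n \<ge> 1" for n using MX[OF that] by simp
    have "(\<lambda>k. 1 - ?\<Phi> (c k) ^ k) \<longlonglongrightarrow> \<alpha>"
    proof (rule Lim_transform_eventually[OF assms(4)])
      show "eventually (\<lambda>k. \<P>(z in std_gaussian k. Max (z ` {1..k}) > c k) = 1 - ?\<Phi> (c k) ^ k) sequentially"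
        \<comment> \<open>The product formula needs \<open>k \<ge> 1\<close>, as the maximum over an
          empty index set is unspecified.\<close>
        using eventually_ge_at_top[of 1] by eventually_elim (rule prob_std_gaussian_Max_gt)
    qed
    moreover have "(\<lambda>n. ?F n x) \<longlonglongrightarrow> ?\<Phi> x" for x
      unfolding normalized_sum_def
    proof (rule clt_triangular_iid[OF P.real_distribution_axioms mom(3) mom(2) mom(4)])
      fix n :: nat assume n: "n \<ge> 1"
      show "prob_space (M n)" using MX[OF n] by simp
      show "prob_space.indep_vars (M n) (\<lambda>_. borel) (\<lambda>i. X n i 1) {1..n}"
        using MX[OF n] by (intro iid_vectors_column(1)[OF _ _ one[OF n]]) auto
      show "distr (M n) borel (X n i 1) = P m" if "i \<in> {1..n}" for i
        using MX[OF n] that by (intro iid_vectors_column(2)[OF _ _ one[OF n]]) auto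
    qed
    ultimately have "eventually (\<lambda>n. (1 - ?F n (c (d n)) ^ d n) - (1 - ?\<Phi> (c (d n)) ^ d n) \<le> 1 - \<alpha> + e) sequentially"
      using assms(3) e by (intro eventually_diff_le) auto
    then show "eventually (\<lambda>n. \<P>(\<omega> in M n. Max (normalized_sum n (\<lambda>i j. X n i j \<omega>) ` {1..d n}) > c (d n))
        - \<P>(z in std_gaussian (d n). Max (z ` {1..d n}) > c (d n)) \<le> 1 - \<alpha> + e) sequentially"
      using eventually_ge_at_top[of 1]
    proof eventually_elim
      case (elim n)
      have "d n \<ge> 1" "prob_space (M n)" "iid_vectors_with_indep_entries (M n) (P m) n (d n) (X n)"
        using MX[OF elim(2)] by auto
      from elim(1)[folded prob_std_gaussian_Max_gt[OF this(1)] prob_iid_vectors_Max_gt[OF this(2,3) elim(2) this(1)]]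
      show ?case .
    qed
    obtain \<delta> where \<delta>: "\<delta> > 0"
      and freq: "frequently (\<lambda>n. real (d n) / real n powr (m/2 - 1 + \<epsilon>) > \<delta>) sequentially"
      using frequently_gt_of_limsup_pos[OF \<epsilon>(2)] .
    have "frequently (\<lambda>n. \<delta> * real n powr (m/2 - 1 + \<epsilon>) \<le> real (d n)) sequentially"
      using frequently_eventually_conj[OF freq eventually_ge_at_top[of 1]]
    proof (rule frequently_elim1)
      fix n assume n: "n \<ge> 1 \<and> real (d n) / real n powr (m/2 - 1 + \<epsilon>) > \<delta>"
      then have "real n powr (m/2 - 1 + \<epsilon>) > 0" by simp
      then show "\<delta> * real n powr (m/2 - 1 + \<epsilon>) \<le> real (d n)"
        using n by (simp only: pos_less_divide_eq less_imp_le)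
    qed
    \<comment> \<open>The estimate holds for all large \<open>n\<close> as an implication, and its
      premise holds for infinitely many \<open>n\<close>.\<close>
    from frequently_eventually_conj[OF this
        eventually_prob_iid_vectors_Max_gt_ge[OF assms(1-3) \<epsilon>(1) \<delta> e assms(4) MX]]
    show "frequently (\<lambda>n. \<P>(\<omega> in M n. Max (normalized_sum n (\<lambda>i j. X n i j \<omega>) ` {1..d n}) > c (d n))
        - \<P>(z in std_gaussian (d n). Max (z ` {1..d n}) > c (d n)) \<ge> 1 - \<alpha> - e) sequentially"
      by (rule frequently_elim1) blast+
  qed
  \<comment> \<open>Since the mean is zero, the variance is the second moment.\<close>
  show ?thesis
    using mom main by (simp add: P.prob_space_axioms) blast
qed

end
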